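(* Let $p$ be an odd prime, let $F/\mathbb{Q}$ be a cyclic extension of degree $p$, let $K=\mathbb{Q}(\zeta_p)$ and $L=FK$, with the terminology "induces" as defined in the context. (a) Suppose that $L=\mathbb{Q}(\zeta_{p^2})$. Then $x\in L^{*}$ induces an $\mathbb{H}_{p^3}$-extension if and only if it induces a $C_{p^2}\rtimes C_p$-extension. (b) Suppose that $L\neq\mathbb{Q}(\zeta_{p^2})$. If an element $x\in L^{*}$ does not induce an $\mathbb{H}_{p^3}$-extension, then it induces a $C_{p^2}\rtimes C_p$-extension. (c) There are infinitely many elements $x\in L^{*}$ which induce both an $\mathbb{H}_{p^3}$-extension and a $C_{p^2}\rtimes C_p$-extension.
   Context: $\zeta_p$ and $\zeta_{p^2}$ are primitive $p$-th and $p^2$-th roots of unity, and all fields lie in a fixed algebraic closure of $\mathbb{Q}$. $(L^* )^p$ is the group of $p$-th powers of elements of $L^*$. Let $e$ be a primitive root modulo $p$ and let $\bar\tau$ be a generator of $\mathrm{Gal}(L/F)$ (cyclic of order $p-1$) with $\bar\tau(\zeta_p)=\zeta_p^{e}$. The homomorphism $\Phi:L^*\to L^*$ is $$\Phi(y)=\prod_{j=0}^{p-2}\bar\tau^{j}(y)^{e^{p-2-j}}=y^{e^{p-2}}\,\bar\tau(y)^{e^{p-3}}\cdots\bar\tau^{p-2}(y).$$ $\mathbb{H}_{p^3}$ and $C_{p^2}\rtimes C_p$ denote the two non-abelian groups of order $p^3$ (of exponent $p$ and $p^2$ respectively). An element $x\in L^*$ is said to induce an $\mathbb{H}_{p^3}$-extension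 (of $\mathbb{Q}$) if $\Phi(\mathrm{N}_{L/K}(x))\notin (L^* )^p$; it is said to induce a $C_{p^2}\rtimes C_p$-extension (of $\mathbb{Q}$) if $\Phi(\zeta_p\mathrm{N}_{L/K}(x))\notin (L^* )^p$. (These are exactly the conditions under which an explicit Kummer-theoretic construction starting from $x$ produces a Galois extension of $\mathbb{Q}$ with the respective group.) *)

theory Defs
  imports
    "HOL-Algebra.Algebra"
    "HOL-Algebra.Algebraic_Closure_Type"
    "HOL-Number_Theory.Number_Theory"
begin

hide_const (open) Divisibility.prime

text \<open>
  The ambient field is a whole type \<open>'a\<close>. All fields are subfields (sets) of it, in the sense of
  HOL-Algebra applied to the ring structure \<^const>\<open>ring_of_type_algebra\<close> of that type.
  Elements are computed with in type-class notation.
\<close>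

abbreviation ambient :: "'a::field ring" where
  "ambient \<equiv> ring_of_type_algebra"

definition primitive_root_of_unity :: "nat \<Rightarrow> 'a::field \<Rightarrow> bool" where
  "primitive_root_of_unity n z \<longleftrightarrow> n > 0 \<and> z ^ n = 1 \<and> (\<forall>k. 0 < k \<and> k < n \<longrightarrow> z ^ k \<noteq> 1)"

text \<open>The elements of the automorphism group of \<open>L\<close> over \<open>K\<close> are functions restricted to \<open>L\<close>
  (\<^const>\<open>undefined\<close> elsewhere), so that distinct elements are distinct automorphisms.\<close>

definition galois_group :: "'a::field set \<Rightarrow> 'a set \<Rightarrow> ('a \<Rightarrow> 'a) monoid" where
  "galois_group L K = (BijGroup L)
     \<lparr>carrier := {\<sigma> \<in> Bij L. \<sigma> \<in> ring_hom (ambient\<lparr>carrier := L\<rparr>) (ambient\<lparr>carrier := L\<rparr>)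
                           \<and> (\<forall>x\<in>K. \<sigma> x = x)}\<rparr>"

definition galois_extension :: "'a::field set \<Rightarrow> 'a set \<Rightarrow> bool" where
  "galois_extension L K \<longleftrightarrow>
     subfield K ambient \<and> subfield L ambient \<and> K \<subseteq> L \<and> ring.finite_dimension ambient K L \<and>
     {x \<in> L. \<forall>\<sigma>\<in>carrier (galois_group L K). \<sigma> x = x} = K"

definition cyclic_extension :: "nat \<Rightarrow> 'a::field set \<Rightarrow> 'a set \<Rightarrow> bool" where
  "cyclic_extension n L K \<longleftrightarrow>
     galois_extension L K \<and> cyclic_group (galois_group L K) \<and> ring.dimension ambient n K L"

text \<open>The relative norm of a finite Galois extension \<open>L\<close> of \<open>K\<close>, as the product of conjugates.\<close>

definition galois_norm :: "'a::field set \<Rightarrow> 'a set \<Rightarrow> 'a \<Rightarrow> 'a" where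
  "galois_norm L K x = (\<Prod>\<sigma>\<in>carrier (galois_group L K). \<sigma> x)"

definition nth_powers :: "nat \<Rightarrow> 'a::field set \<Rightarrow> 'a set" where
  "nth_powers n L = {y ^ n | y. y \<in> L - {0}}"

definition Phi :: "nat \<Rightarrow> nat \<Rightarrow> ('a \<Rightarrow> 'a) \<Rightarrow> 'a::field \<Rightarrow> 'a" where
  "Phi p e \<tau> y = (\<Prod>j = 0..p - 2. ((\<tau> ^^ j) y) ^ (e ^ (p - 2 - j)))"

definition induces_Heisenberg ::
    "nat \<Rightarrow> nat \<Rightarrow> ('a \<Rightarrow> 'a) \<Rightarrow> 'a::field set \<Rightarrow> 'a set \<Rightarrow> 'a \<Rightarrow> bool" where
  "induces_Heisenberg p e \<tau> L K x \<longleftrightarrow> Phi p e \<tau> (galois_norm L K x) \<notin> nth_powers p L"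

definition induces_semidirect ::
    "nat \<Rightarrow> nat \<Rightarrow> ('a \<Rightarrow> 'a) \<Rightarrow> 'a \<Rightarrow> 'a::field set \<Rightarrow> 'a set \<Rightarrow> 'a \<Rightarrow> bool" where
  "induces_semidirect p e \<tau> \<zeta> L K x \<longleftrightarrow> Phi p e \<tau> (\<zeta> * galois_norm L K x) \<notin> nth_powers p L"

end

theory Submission
  imports Defs
begin

text \<open>
  The map \<open>\<Phi>\<close> is multiplicative and \<open>\<Phi> \<zeta>\<close> is a power of \<open>\<zeta>\<close> with exponent prime to \<open>p\<close>, so the two conditions
  differ by the class of \<open>\<zeta>\<close> modulo \<open>p\<close>-th powers. That class is trivial exactly when \<open>L\<close> contains a primitive
  \<open>p\<^sup>2\<close>-th root of unity. Such a root does not lie in \<open>K\<close>; hence, as \<open>F\<close> has prime degree, it generates \<open>L\<close>, by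
  Lagrange resolvents. This gives (a) and (b).

  For (c), one element suffices, because it can be multiplied by \<open>p\<close>-th powers. Take a prime of \<open>L\<close>
  that is unramified of degree one over \<open>\<rat>\<close>, with valuation \<open>v\<close>, and \<open>x\<close> such that \<open>v\<close> is nonnegative
  on all conjugates of \<open>x\<close> and \<open>v\<close> of the absolute norm of \<open>x\<close> is 1. Then exactly one conjugate of \<open>x\<close>
  has nonzero valuation, so \<open>v (\<Phi> (N x))\<close> is a power of \<open>e\<close> and prime to \<open>p\<close>, while \<open>v\<close> is a multiple
  of \<open>p\<close> on \<open>p\<close>-th powers and vanishes at \<open>\<zeta>\<close>.
\<close>

section \<open>Integer polynomials\<close>

text \<open>The valuation comes from evaluating integer polynomials in two places: at a primitive
  element \<open>\<theta>\<close> by \<open>ieval\<close>, and at an integer \<open>t\<close> modulo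
  a prime \<open>q\<close> by \<open>poly\<close>. If \<open>t\<close> is a simple root modulo
  \<open>q\<close> of the polynomial of \<open>\<theta>\<close>, sending \<open>\<theta>\<close> to
  \<open>t\<close> is a reduction map, and \<open>q\<close> generates the maximal ideal of the
  resulting local ring. If moreover \<open>q\<close> divides the value at \<open>t\<close> exactly
  once, then \<open>\<theta> - t\<close> has a norm of valuation 1.

  Elements of \<open>L\<close> are written with \<open>p\<close> coefficients over \<open>F\<close>,
  one for each power of \<open>\<zeta>\<close>. Since these powers sum to 0, such an expression is
  unique only up to adding one constant to all coefficients. This is why linear disjointness appears
  as an equality of coefficients, and why the coefficient at 0 is often normalised to 0.

  The obstacle in (b) is a possible root of \<open>y ^ p = \<zeta>\<close> inside \<open>K\<close>.
  It is excluded by arithmetic; after that, the stabiliser of \<open>y\<close> in the group of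
  \<open>F\<close> must be trivial, which is what the resolvents require.

  In (c) the maps \<open>\<tau> ^^ j\<close> for \<open>j < p - 1\<close> represent the cosets of
  the group of \<open>L\<close> over \<open>K\<close>. Hence \<open>\<Phi> (N x)\<close> collects
  every conjugate of \<open>x\<close> once, each with a power of \<open>e\<close> as its
  weight.\<close>

definition ieval :: "int poly \<Rightarrow> 'a::field_char_0 \<Rightarrow> 'a" where
  "ieval g x = poly (map_poly of_int g) x"

lemma ieval_0 [simp]: "ieval 0 x = 0"
  by (simp add: ieval_def)

lemma ieval_pCons [simp]: "ieval (pCons a g) x = of_int a + x * ieval g x"
  by (simp add: ieval_def map_poly_pCons)

lemma ieval_1 [simp]: "ieval 1 x = 1"
  by (simp add: ieval_def)

lemma ieval_add [simp]: "ieval (g + h) x = ieval g x + ieval h x"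
proof -
  have "map_poly of_int (g + h) = (map_poly of_int g + map_poly of_int h :: 'a poly)"
    by (rule poly_eqI) (simp add: coeff_map_poly)
  then show ?thesis by (simp add: ieval_def)
qed

lemma ieval_smult [simp]: "ieval (smult c g) x = of_int c * ieval g x"
  by (induction g) (auto simp: algebra_simps)

lemma ieval_mult [simp]: "ieval (g * h) x = ieval g x * ieval h x"
  by (induction g) (auto simp: algebra_simps)

lemma ieval_minus [simp]: "ieval (- g) x = - ieval g x"
  using ieval_smult[of "-1" g x] by simp

lemma ieval_diff [simp]: "ieval (g - h) x = ieval g x - ieval h x"
  using ieval_add[of g "- h" x] by simp

lemma ieval_power [simp]: "ieval (g ^ n) x = ieval g x ^ n"
  by (induction n) auto

lemma ieval_sum [simp]: "ieval (\<Sum>i\<in>I. f i) x = (\<Sum>i\<in>I. ieval (f i) x)"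
  by (induction I rule: infinite_finite_induct) auto

lemma ieval_of_int [simp]: "ieval g (of_int t) = of_int (poly g t)"
  by (induction g) auto

lemma ieval_monom [simp]: "ieval (monom c n) x = of_int c * x ^ n"
  by (induction n) (auto simp: monom_0 monom_Suc)

lemma ieval_pcompose [simp]: "ieval (pcompose g h) x = ieval g (ieval h x)"
  by (induction g) (auto simp: pcompose_pCons)

lemma ieval_altdef: "ieval g x = (\<Sum>i\<le>degree g. of_int (coeff g i) * x ^ i)"
  by (simp add: ieval_def poly_altdef degree_map_poly coeff_map_poly)

lemma rat_poly_clear_denominators:
  fixes P :: "'a::field_char_0 poly"
  assumes "\<And>i. coeff P i \<in> \<rat>"
  shows "\<exists>D Q. D > 0 \<and> smult (of_int D) P = map_poly of_int Q"
  using assms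
proof (induction P)
  case 0
  show ?case by (intro exI[of _ 1] exI[of _ 0]) simp
next
  case (pCons a P)
  have "coeff P i \<in> \<rat>" for i using pCons.prems[of "Suc i"] by simp
  with pCons.IH obtain D Q where D: "D > 0" "smult (of_int D) P = map_poly of_int Q" by blast
  have "a \<in> \<rat>" using pCons.prems[of 0] by simp
  then obtain m d where md: "d > 0" "a = of_int m / of_int d" by (auto elim: Rats_cases')
  have "smult (of_int (D * d)) (pCons a P) = map_poly of_int (pCons (D * m) (smult d Q))"
  proof -
    have "map_poly of_int (smult d Q) = smult (of_int d) (map_poly of_int Q :: 'a poly)"
      by (rule poly_eqI) (simp add: coeff_map_poly)
    then show ?thesis using md D(2)[symmetric] by (simp add: map_poly_pCons mult.commute)
  qed
  then show ?case using D(1) md(1) by (intro exI[of _ "D * d"] exI) auto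
qed

text \<open>Euclid's argument in Schur's form: with constant term \<open>c\<close>, the value at a
  multiple of \<open>c * R\<close> is \<open>c * u\<close> with \<open>u\<close> congruent to 1
  modulo \<open>R\<close>. A prime factor of \<open>u\<close> therefore avoids
  \<open>R\<close>.\<close>

lemma exists_prime_divisor_of_value:
  fixes f :: "int poly"
  assumes deg: "degree f > 0" and R: "R \<noteq> 0"
  shows "\<exists>q t. prime q \<and> \<not> q dvd R \<and> q dvd poly f t"
proof (cases "poly f 0 = 0")
  case True
  have "\<exists>q::nat. prime q \<and> nat \<bar>R\<bar> < q" by (rule bigger_prime)
  then obtain q :: nat where q: "prime q" "nat \<bar>R\<bar> < q" by blast
  have "\<not> int q dvd R" using q(2) R zdvd_imp_le[of "int q" "\<bar>R\<bar>"] by auto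
  then show ?thesis using q(1) True by (intro exI[of _ "int q"] exI[of _ 0]) simp
next
  case False
  define c where "c = poly f 0"
  have c: "c \<noteq> 0" using False by (simp add: c_def)
  obtain g where g: "f = pCons c g" using c_def by (cases f) auto
  \<comment> \<open>The three sets are the places where the cofactor \<open>u\<close> would be 1, -1
    or 0, and so might have no usable prime factor.\<close>
  define S where "S = {x. poly (f - [:c:]) x = 0} \<union> {x. poly (f + [:c:]) x = 0} \<union> {x. poly f x = 0}"
  have "f - [:c:] \<noteq> 0" "f + [:c:] \<noteq> 0" "f \<noteq> 0" using deg by (auto simp: g split: if_splits)
  then have "finite S" unfolding S_def by (intro finite_UnI poly_roots_finite)
  moreover have "infinite (range (\<lambda>k::nat. c * R * int k))"
    by (rule range_inj_infinite) (use c R in \<open>auto simp: inj_def\<close>)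
  ultimately obtain k where k: "c * R * int k \<notin> S"
    by (metis finite_subset image_subsetI)
  define t where "t = c * R * int k"
  define u where "u = 1 + R * int k * poly g t"
  have ft: "poly f t = c * u" by (simp add: g t_def u_def algebra_simps)
  have "u \<noteq> 0" "u \<noteq> 1" "u \<noteq> -1" using k ft by (auto simp: S_def simp flip: t_def)
  then have "u \<noteq> 0" "\<not> is_unit u" by (auto simp: abs_if)
  from prime_divisor_exists[OF this] obtain q where q: "prime q" "q dvd u" by blast
  have "\<not> q dvd R"
  proof
    assume "q dvd R"
    then have "q dvd u - R * int k * poly g t" using q by (intro dvd_diff) auto
    then show False using q(1) by (simp add: u_def not_prime_unit)
  qed
  then show ?thesis using q ft by (intro exI[of _ q] exI[of _ t]) simp
qed

lemma poly_add_multiple_mod_square: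
  fixes f :: "int poly"
  shows "q\<^sup>2 dvd poly f (t + q) - poly f t - q * poly (pderiv f) t"
proof (induction f)
  case 0
  show ?case by simp
next
  case (pCons a f)
  then obtain r where "poly f (t + q) - poly f t - q * poly (pderiv f) t = q\<^sup>2 * r" by blast
  then have r: "poly f (t + q) = poly f t + q * poly (pderiv f) t + q\<^sup>2 * r" by simp
  have "poly (pCons a f) (t + q) - poly (pCons a f) t - q * poly (pderiv (pCons a f)) t
      = q\<^sup>2 * (poly (pderiv f) t + (t + q) * r)"
    unfolding poly_pCons pderiv_pCons poly_add r by (simp add: algebra_simps power2_eq_square)
  then show ?case by simp
qed

lemma cong_poly_int:
  fixes f :: "int poly"
  assumes "q dvd s - t" shows "q dvd poly f s - poly f t"
proof (induction f)
  case (pCons a f)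
  have "poly (pCons a f) s - poly (pCons a f) t = s * (poly f s - poly f t) + (s - t) * poly f t"
    by (simp add: algebra_simps)
  then show ?case using pCons.IH assms by simp
qed simp

text \<open>Modulo \<open>q\<^sup>2\<close> the values at \<open>t\<close> and \<open>t + q\<close>
  differ by \<open>q\<close> times the derivative at \<open>t\<close>. As \<open>q\<close> does not
  divide that derivative, \<open>q\<^sup>2\<close> cannot divide both values.\<close>

lemma exact_prime_divisor_of_value:
  fixes f :: "int poly"
  assumes "q dvd poly f t" and "\<not> q dvd poly (pderiv f) t" and "prime q"
  shows "\<exists>s. q dvd s - t \<and> q dvd poly f s \<and> \<not> q\<^sup>2 dvd poly f s"
proof (cases "q\<^sup>2 dvd poly f t")
  case False
  then show ?thesis using assms by (intro exI[of _ t]) simp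
next
  case True
  have q: "q \<noteq> 0" using assms(3) by auto
  have "\<not> q\<^sup>2 dvd poly f (t + q)"
  proof
    assume "q\<^sup>2 dvd poly f (t + q)"
    then have "q\<^sup>2 dvd poly f (t + q) - poly f t" using True by simp
    from dvd_diff[OF this poly_add_multiple_mod_square[of q f t]]
    have "q\<^sup>2 dvd q * poly (pderiv f) t" by simp
    then show False using assms(2) q by (simp add: power2_eq_square)
  qed
  moreover have "q dvd poly f (t + q)"
    using cong_poly_int[of q "t + q" t f] assms(1) by (simp add: dvd_diff_right_iff dvd_diff_left_iff)
  ultimately show ?thesis by (intro exI[of _ "t + q"]) simp
qed

section \<open>The valuation at a simple root modulo a prime\<close>

text \<open>The setting is the local ring of \<open>Z[\<theta>]\<close> at the kernel of the map
  sending \<open>\<theta>\<close> to \<open>t\<close> modulo \<open>q\<close>. Assumption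
  \<open>reduction\<close> makes this map well defined, \<open>simple\<close> makes the prime
  unramified, and \<open>algebraic_values\<close> makes each nonzero element divide a nonzero
  integer, which bounds its valuation.\<close>

locale simple_residue_root =
  fixes \<theta> :: "'a::field_char_0" and M :: "int poly" and q t :: int
  assumes prime_q: "prime q"
    and root: "ieval M \<theta> = 0"
    and residue_root: "q dvd poly M t"
    and simple: "\<not> q dvd poly (pderiv M) t"
    and reduction: "\<And>g. ieval g \<theta> = 0 \<Longrightarrow> q dvd poly g t"
    and algebraic_values: "\<And>g. algebraic (ieval g \<theta>)"
begin

text \<open>These are the units of the local ring: numerator and denominator both have nonzero
  residue. By \<open>reduction\<close> such a denominator is itself nonzero.\<close>

definition local_unit :: "'a \<Rightarrow> bool" where
  "local_unit u \<longleftrightarrow> (\<exists>a b. \<not> q dvd poly a t \<and> \<not> q dvd poly b t \<and> u * ieval b \<theta> = ieval a \<theta>)"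

definition fraction :: "'a \<Rightarrow> bool" where
  "fraction y \<longleftrightarrow> (\<exists>a b. ieval b \<theta> \<noteq> 0 \<and> y * ieval b \<theta> = ieval a \<theta>)"

definition has_valuation :: "'a \<Rightarrow> int \<Rightarrow> bool" where
  "has_valuation y n \<longleftrightarrow> (\<exists>u. local_unit u \<and> y = u * of_int q powi n)"

definition val :: "'a \<Rightarrow> int" where
  "val y = (THE n. has_valuation y n)"

lemma q_nonzero [simp]: "q \<noteq> 0"
  using prime_q by auto

lemma q_dvd_mult_iff: "q dvd a * b \<longleftrightarrow> q dvd a \<or> q dvd b"
  using prime_q by (simp add: prime_dvd_mult_iff)

lemma ieval_nonzero: "\<not> q dvd poly a t \<Longrightarrow> ieval a \<theta> \<noteq> 0"
  using reduction by blast

lemma local_unitI: "\<not> q dvd poly a t \<Longrightarrow> \<not> q dvd poly b t \<Longrightarrow> u * ieval b \<theta> = ieval a \<theta> \<Longrightarrow> local_unit u"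
  by (auto simp: local_unit_def)

lemma local_unit_ieval: "\<not> q dvd poly a t \<Longrightarrow> local_unit (ieval a \<theta>)"
  using prime_q by (intro local_unitI[of a 1]) (auto simp: not_prime_unit)

lemma local_unit_nonzero: "local_unit u \<Longrightarrow> u \<noteq> 0"
  using ieval_nonzero by (auto simp: local_unit_def)

lemma local_unit_mult:
  assumes "local_unit u" "local_unit v" shows "local_unit (u * v)"
proof -
  from assms obtain a b c d where nd: "\<not> q dvd poly a t" "\<not> q dvd poly b t"
      "\<not> q dvd poly c t" "\<not> q dvd poly d t"
    and eq: "ieval a \<theta> = u * ieval b \<theta>" "ieval c \<theta> = v * ieval d \<theta>"
    unfolding local_unit_def by metis
  show ?thesis
    by (rule local_unitI[of "a * c" "b * d"]) (simp_all add: q_dvd_mult_iff nd eq mult_ac)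
qed

lemma local_unit_divide:
  assumes "local_unit u" "local_unit v" shows "local_unit (u / v)"
proof -
  from assms obtain a b c d where nd: "\<not> q dvd poly a t" "\<not> q dvd poly b t"
      "\<not> q dvd poly c t" "\<not> q dvd poly d t"
    and eq: "ieval a \<theta> = u * ieval b \<theta>" "ieval c \<theta> = v * ieval d \<theta>"
    unfolding local_unit_def by metis
  have "v \<noteq> 0" using assms local_unit_nonzero by blast
  then show ?thesis
    by (intro local_unitI[of "a * d" "b * c"]) (simp_all add: q_dvd_mult_iff nd eq mult_ac)
qed

text \<open>A positive power of \<open>q\<close> has residue 0, whereas a unit has nonzero residue.
  This makes the valuation unique.\<close>

lemma q_power_not_local_unit:
  assumes "n > 0" shows "\<not> local_unit (of_int q ^ n)"
proof
  assume "local_unit (of_int q ^ n)"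
  then obtain a b where ab: "\<not> q dvd poly a t" "of_int q ^ n * ieval b \<theta> = ieval a \<theta>"
    unfolding local_unit_def by blast
  then have "ieval (smult (q ^ n) b - a) \<theta> = 0" by simp
  from reduction[OF this] have "q dvd q ^ n * poly b t - poly a t" by simp
  moreover have "q dvd q ^ n * poly b t" using assms by (simp add: dvd_power)
  ultimately show False using ab(1) by (metis dvd_diff_right_iff)
qed

text \<open>Since the residue root is simple, \<open>\<theta> - t\<close> is a multiple of \<open>q\<close> in the local ring, so \<open>q\<close>
  generates the maximal ideal.\<close>

lemma extract_q:
  assumes "q dvd poly g t"
  shows "\<exists>h b. \<not> q dvd poly b t \<and> ieval g \<theta> * ieval b \<theta> = of_int q * ieval h \<theta>"
proof -
  define m where "m = synthetic_div M t"
  define g1 where "g1 = synthetic_div g t"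
  have M: "M = [:-t, 1:] * m + [:poly M t:]"
    unfolding m_def by (rule synthetic_div_correct'[symmetric])
  have g: "g = [:-t, 1:] * g1 + [:poly g t:]"
    unfolding g1_def by (rule synthetic_div_correct'[symmetric])
  obtain s where s: "poly M t = q * s" using residue_root by blast
  obtain k where k: "poly g t = q * k" using assms by blast
  \<comment> \<open>The cofactor \<open>m\<close> of \<open>X - t\<close> takes at \<open>t\<close>
    the value of the derivative of \<open>M\<close>, which is nonzero modulo \<open>q\<close>. So
    \<open>m\<close> serves as the denominator that turns \<open>\<theta> - t\<close> into a
    multiple of \<open>q\<close>.\<close>
  have "pderiv M = pderiv ([:-t, 1:] * m + [:poly M t:])" using M by simp
  then have "poly (pderiv M) t = poly m t"
    by (simp add: pderiv_add pderiv_mult pderiv_pCons del: mult_pCons_left)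
  then have mt: "\<not> q dvd poly m t" using simple by simp
  have "ieval M \<theta> = (\<theta> - of_int t) * ieval m \<theta> + of_int (poly M t)"
    by (subst M) (simp del: mult_pCons_left)
  then have eq: "(\<theta> - of_int t) * ieval m \<theta> = - of_int (q * s)" using root s by (simp add: eq_neg_iff_add_eq_0)
  have "ieval g \<theta> = (\<theta> - of_int t) * ieval g1 \<theta> + of_int (q * k)"
    by (subst g) (simp add: k del: mult_pCons_left)
  then have "ieval g \<theta> * ieval m \<theta> = ((\<theta> - of_int t) * ieval m \<theta>) * ieval g1 \<theta> + of_int (q * k) * ieval m \<theta>"
    by (simp only: distrib_right distrib_left mult_ac)
  also have "\<dots> = of_int q * ieval (smult k m - smult s g1) \<theta>"
    unfolding eq by (simp add: algebra_simps)
  finally show ?thesis using mt by blast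
qed

text \<open>The integer \<open>N\<close> bounds how often \<open>q\<close> can be extracted. If the
  residue of \<open>g\<close> is 0, then \<open>q\<close> divides \<open>N * poly b t\<close> and
  hence \<open>N\<close>, so each extraction replaces \<open>N\<close> by \<open>N div q\<close>;
  the polynomial \<open>b\<close> accumulates the denominators.\<close>

lemma ieval_factorization_aux:
  assumes "ieval g \<theta> * ieval h \<theta> = of_int N * ieval b \<theta>" "\<not> q dvd poly b t" "N \<noteq> 0"
  shows "\<exists>u n. local_unit u \<and> ieval g \<theta> = u * of_int q ^ n"
  using assms
proof (induction "nat \<bar>N\<bar>" arbitrary: g b N rule: less_induct)
  case less
  show ?case
  proof (cases "q dvd poly g t")
    case False
    then show ?thesis using local_unit_ieval by (intro exI[of _ "ieval g \<theta>"] exI[of _ 0]) simp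
  next
    case True
    have "ieval (g * h - smult N b) \<theta> = 0" using less.prems by simp
    from reduction[OF this] have "q dvd poly g t * poly h t - N * poly b t" by simp
    then have "q dvd N * poly b t" using True by (metis dvd_diff_right_iff dvd_mult2)
    then have "q dvd N" using less.prems by (simp add: q_dvd_mult_iff)
    then obtain N' where N': "N = q * N'" by blast
    from extract_q[OF True] obtain g' b' where b': "\<not> q dvd poly b' t"
      "ieval g \<theta> * ieval b' \<theta> = of_int q * ieval g' \<theta>" by blast
    have "of_int q * (ieval g' \<theta> * ieval h \<theta>) = (ieval g \<theta> * ieval h \<theta>) * ieval b' \<theta>"
      using b'(2) by (simp add: algebra_simps)
    also have "\<dots> = of_int q * (of_int N' * ieval (b * b') \<theta>)"
      unfolding less.prems(1) N' by simp
    finally have eq: "ieval g' \<theta> * ieval h \<theta> = of_int N' * ieval (b * b') \<theta>" by simp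
    have "N' \<noteq> 0" using less.prems N' by auto
    have "\<bar>q\<bar> > 1" using prime_gt_1_int[OF prime_q] by simp
    then have "nat \<bar>N'\<bar> < nat \<bar>N\<bar>" using \<open>N' \<noteq> 0\<close> by (simp add: N' abs_mult)
    moreover have "\<not> q dvd poly (b * b') t" using b' less.prems by (simp add: q_dvd_mult_iff)
    ultimately obtain u n where un: "local_unit u" "ieval g' \<theta> = u * of_int q ^ n"
      using less.hyps[OF _ eq] \<open>N' \<noteq> 0\<close> by blast
    have "ieval b' \<theta> \<noteq> 0" using ieval_nonzero b' by blast
    then have "ieval g \<theta> = (u / ieval b' \<theta>) * of_int q ^ Suc n"
      using b'(2) un(2) by (simp add: field_simps)
    moreover have "local_unit (u / ieval b' \<theta>)"
      using un b' local_unit_ieval local_unit_divide by blast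
    ultimately show ?thesis by blast
  qed
qed

text \<open>A nonzero algebraic element divides the constant term of an integer polynomial that
  vanishes at it, if this term is nonzero. That term is the \<open>N\<close> of the preceding
  induction.\<close>

lemma ieval_factorization:
  assumes "ieval g \<theta> \<noteq> 0"
  shows "\<exists>u n. local_unit u \<and> ieval g \<theta> = u * of_int q ^ n"
proof -
  obtain P where P: "coeff P 0 \<noteq> 0" "ieval P (ieval g \<theta>) = 0"
    using algebraicE'_nonzero[OF algebraic_values assms] by (auto simp: ieval_def)
  obtain c P' where P': "P = pCons c P'" by (cases P)
  have *: "ieval g \<theta> * ieval (pcompose P' g) \<theta> = of_int (- c) * ieval 1 \<theta>"
    using P(2) by (simp add: P' eq_neg_iff_add_eq_0 add.commute)
  have "\<not> q dvd poly 1 t" using not_prime_unit[of q] prime_q by auto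
  then show ?thesis using P(1) P' ieval_factorization_aux[OF *] by auto
qed

lemma has_valuation_exists:
  assumes "fraction y" "y \<noteq> 0"
  shows "\<exists>n. has_valuation y n"
proof -
  obtain a b where ab: "ieval b \<theta> \<noteq> 0" "y * ieval b \<theta> = ieval a \<theta>"
    using assms(1) unfolding fraction_def by blast
  then have "ieval a \<theta> \<noteq> 0" using assms(2) by auto
  then obtain u n v m where "local_unit u" "ieval a \<theta> = u * of_int q ^ n"
    "local_unit v" "ieval b \<theta> = v * of_int q ^ m"
    using ieval_factorization ab(1) by metis
  then have "y = (u / v) * of_int q powi (int n - int m)"
    using ab local_unit_nonzero[of v] by (simp add: power_int_diff field_simps)
  then show ?thesis unfolding has_valuation_def
    using local_unit_divide \<open>local_unit u\<close> \<open>local_unit v\<close> by blast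
qed

lemma has_valuation_le:
  assumes "has_valuation y n" "has_valuation y m"
  shows "n \<le> m"
proof (rule ccontr)
  assume "\<not> n \<le> m"
  obtain u v where uv: "local_unit u" "local_unit v" "u * of_int q powi n = v * of_int q powi m"
    using assms unfolding has_valuation_def by blast
  then have "of_int q powi (n - m) = v / u"
    using local_unit_nonzero by (simp add: power_int_diff field_simps)
  moreover have "of_int q powi (n - m) = (of_int q :: 'a) ^ nat (n - m)"
    using \<open>\<not> n \<le> m\<close> by (simp add: power_int_def)
  ultimately show False
    using q_power_not_local_unit[of "nat (n - m)"] local_unit_divide[OF uv(2,1)] \<open>\<not> n \<le> m\<close> by simp
qed

lemma val_eqI: "has_valuation y n \<Longrightarrow> val y = n"
  unfolding val_def using has_valuation_le by (intro the_equality) (auto intro: antisym)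

lemma has_valuation_val: "fraction y \<Longrightarrow> y \<noteq> 0 \<Longrightarrow> has_valuation y (val y)"
  using has_valuation_exists val_eqI by metis

lemma val_mult:
  assumes "fraction x" "x \<noteq> 0" "fraction y" "y \<noteq> 0"
  shows "val (x * y) = val x + val y"
proof -
  obtain n m where "has_valuation x n" "has_valuation y m"
    using has_valuation_exists assms by metis
  then obtain u v where uv: "local_unit u" "x = u * of_int q powi n" "local_unit v" "y = v * of_int q powi m"
    unfolding has_valuation_def by blast
  then have "x * y = (u * v) * of_int q powi (n + m)"
    by (simp add: power_int_add)
  then have "has_valuation (x * y) (n + m)"
    using local_unit_mult uv(1,3) unfolding has_valuation_def by blast
  then show ?thesis
    using \<open>has_valuation x n\<close> \<open>has_valuation y m\<close> val_eqI by metis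
qed

lemma val_local_unit: "local_unit u \<Longrightarrow> val u = 0"
  by (rule val_eqI) (auto simp: has_valuation_def)

lemma val_q_times_local_unit: "local_unit u \<Longrightarrow> val (of_int q * u) = 1"
  by (rule val_eqI) (auto simp: has_valuation_def mult.commute)

lemma local_unit_of_int: "\<not> q dvd c \<Longrightarrow> local_unit (of_int c)"
  using local_unit_ieval[of "[:c:]"] by simp

text \<open>The hypothesis on \<open>P\<close> says that \<open>y\<close> is integral over the local
  ring, and a valuation ring is integrally closed.\<close>

lemma val_nonneg:
  assumes "fraction y" "y \<noteq> 0" and P: "ieval P y = 0" "\<not> q dvd lead_coeff P"
  shows "val y \<ge> 0"
proof (rule ccontr)
  assume neg: "\<not> val y \<ge> 0"
  define k where "k = nat (- val y)"
  have k: "k > 0" "val y = - int k" using neg by (auto simp: k_def)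
  obtain u where "local_unit u" and yu: "y = u * of_int q powi (- int k)"
    using has_valuation_val assms k unfolding has_valuation_def by metis
  have "u = y * of_int q ^ k" unfolding yu by (simp add: power_int_minus)
  with \<open>local_unit u\<close> obtain a b where ab: "\<not> q dvd poly a t"
    "y * of_int q ^ k * ieval b \<theta> = ieval a \<theta>"
    unfolding local_unit_def by blast
  define B where "B = smult (q ^ k) b"
  define d where "d = degree P"
  have yB: "ieval a \<theta> = y * ieval B \<theta>" using ab(2) by (simp add: B_def mult.assoc)
  \<comment> \<open>The homogenisation of \<open>P\<close> at the fraction \<open>a / B\<close> that
    represents \<open>y\<close>. As \<open>q\<close> divides \<open>B\<close>, only the leading term
    survives the reduction, and its residue is nonzero.\<close>
  define G where "G = (\<Sum>i\<le>d. smult (coeff P i) (a ^ i * B ^ (d - i)))"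
  have "ieval G \<theta> = (\<Sum>i\<le>d. ieval B \<theta> ^ d * (of_int (coeff P i) * y ^ i))"
    unfolding G_def ieval_sum
  proof (rule sum.cong)
    fix i assume "i \<in> {..d}"
    then have "ieval B \<theta> ^ d = ieval B \<theta> ^ i * ieval B \<theta> ^ (d - i)" by (simp flip: power_add)
    then show "ieval (smult (coeff P i) (a ^ i * B ^ (d - i))) \<theta> = ieval B \<theta> ^ d * (of_int (coeff P i) * y ^ i)"
      by (simp add: yB power_mult_distrib mult_ac)
  qed simp
  also have "\<dots> = ieval B \<theta> ^ d * ieval P y"
    by (simp add: ieval_altdef sum_distrib_left d_def)
  finally have "ieval G \<theta> = 0" using P by simp
  then have "q dvd poly G t" by (rule reduction)
  have "{..d} = insert d {..<d}" by auto
  then have "poly G t = coeff P d * poly a t ^ d + (\<Sum>i<d. coeff P i * (poly a t ^ i * poly B t ^ (d - i)))"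
    by (simp add: G_def poly_sum)
  moreover have "q dvd (\<Sum>i<d. coeff P i * (poly a t ^ i * poly B t ^ (d - i)))"
  proof (rule dvd_sum)
    fix i assume "i \<in> {..<d}"
    have "q dvd poly B t" using k by (simp add: B_def dvd_power)
    also have "poly B t dvd poly B t ^ (d - i)" using \<open>i \<in> {..<d}\<close> by (intro dvd_power) auto
    finally show "q dvd coeff P i * (poly a t ^ i * poly B t ^ (d - i))" by simp
  qed
  ultimately have "q dvd coeff P d * poly a t ^ d"
    using \<open>q dvd poly G t\<close> by (simp add: dvd_add_left_iff)
  then show False using ab P(2) prime_q by (auto simp: q_dvd_mult_iff d_def dest: prime_dvd_power)
qed

end

section \<open>Subfields and their automorphisms\<close>

locale field_set =
  fixes E :: "'a::field_char_0 set"
  assumes one_closed [simp]: "1 \<in> E"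
    and minus_closed [simp]: "x \<in> E \<Longrightarrow> - x \<in> E"
    and add_closed [simp]: "x \<in> E \<Longrightarrow> y \<in> E \<Longrightarrow> x + y \<in> E"
    and mult_closed [simp]: "x \<in> E \<Longrightarrow> y \<in> E \<Longrightarrow> x * y \<in> E"
    and inverse_closed [simp]: "x \<in> E \<Longrightarrow> inverse x \<in> E"
begin

lemma zero_closed [simp]: "0 \<in> E"
  using add_closed[OF one_closed minus_closed[OF one_closed]] by simp

lemma diff_closed [simp]: "x \<in> E \<Longrightarrow> y \<in> E \<Longrightarrow> x - y \<in> E"
  using add_closed[of x "- y"] by simp

lemma divide_closed [simp]: "x \<in> E \<Longrightarrow> y \<in> E \<Longrightarrow> x / y \<in> E"
  by (simp add: divide_inverse)

lemma power_closed [simp]: "x \<in> E \<Longrightarrow> x ^ n \<in> E"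
  by (induction n) auto

lemma sum_closed: "(\<And>i. i \<in> I \<Longrightarrow> f i \<in> E) \<Longrightarrow> (\<Sum>i\<in>I. f i) \<in> E"
  by (induction I rule: infinite_finite_induct) auto

lemma prod_closed: "(\<And>i. i \<in> I \<Longrightarrow> f i \<in> E) \<Longrightarrow> (\<Prod>i\<in>I. f i) \<in> E"
  by (induction I rule: infinite_finite_induct) auto

lemma of_nat_closed [simp]: "of_nat n \<in> E"
  by (induction n) auto

lemma of_int_closed [simp]: "of_int n \<in> E"
  by (cases n) auto

lemma Rats_subset: "\<rat> \<subseteq> E"
  by (auto elim!: Rats_cases')

lemma ieval_closed [simp]: "x \<in> E \<Longrightarrow> ieval g x \<in> E"
  by (induction g) auto

lemma coeff_mult_closed:
  "(\<And>i. coeff P i \<in> E) \<Longrightarrow> (\<And>i. coeff Q i \<in> E) \<Longrightarrow> coeff (P * Q) i \<in> E"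
  by (auto simp: coeff_mult intro!: sum_closed)

lemma coeff_prod_closed:
  "(\<And>k j. k \<in> I \<Longrightarrow> coeff (f k) j \<in> E) \<Longrightarrow> coeff (\<Prod>k\<in>I. f k) i \<in> E"
proof (induction I arbitrary: i rule: infinite_finite_induct)
  case (insert k I)
  then show ?case by (auto intro!: coeff_mult_closed)
qed (auto simp: coeff_1)

lemma coeff_linear_closed: "a \<in> E \<Longrightarrow> coeff [:- a, 1:] i \<in> E"
  by (auto simp: coeff_pCons split: nat.splits)

end

text \<open>Nothing is required outside \<open>E\<close>, so iterates such as
  \<open>\<tau> ^^ 0\<close> qualify as well as the restricted functions in
  \<open>galois_group\<close>.\<close>

locale field_endo = field_set E for E :: "'a::field_char_0 set" +
  fixes \<sigma> :: "'a \<Rightarrow> 'a"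
  assumes maps [simp]: "x \<in> E \<Longrightarrow> \<sigma> x \<in> E"
    and hom_add: "x \<in> E \<Longrightarrow> y \<in> E \<Longrightarrow> \<sigma> (x + y) = \<sigma> x + \<sigma> y"
    and hom_mult: "x \<in> E \<Longrightarrow> y \<in> E \<Longrightarrow> \<sigma> (x * y) = \<sigma> x * \<sigma> y"
    and hom_1 [simp]: "\<sigma> 1 = 1"
begin

lemma hom_0 [simp]: "\<sigma> 0 = 0"
  using hom_add[of 0 0] by simp

lemma hom_minus: "x \<in> E \<Longrightarrow> \<sigma> (- x) = - \<sigma> x"
  using hom_add[of x "- x"] by (simp add: eq_neg_iff_add_eq_0 add.commute)

lemma hom_diff: "x \<in> E \<Longrightarrow> y \<in> E \<Longrightarrow> \<sigma> (x - y) = \<sigma> x - \<sigma> y"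
  using hom_add[of x "- y"] by (simp add: hom_minus)

lemma hom_sum: "(\<And>i. i \<in> I \<Longrightarrow> f i \<in> E) \<Longrightarrow> \<sigma> (\<Sum>i\<in>I. f i) = (\<Sum>i\<in>I. \<sigma> (f i))"
  by (induction I rule: infinite_finite_induct) (auto simp: hom_add sum_closed)

lemma hom_prod: "(\<And>i. i \<in> I \<Longrightarrow> f i \<in> E) \<Longrightarrow> \<sigma> (\<Prod>i\<in>I. f i) = (\<Prod>i\<in>I. \<sigma> (f i))"
  by (induction I rule: infinite_finite_induct) (auto simp: hom_mult prod_closed)

lemma hom_power: "x \<in> E \<Longrightarrow> \<sigma> (x ^ n) = \<sigma> x ^ n"
  by (induction n) (auto simp: hom_mult)

lemma hom_of_nat [simp]: "\<sigma> (of_nat n) = of_nat n"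
  by (induction n) (auto simp: hom_add)

lemma hom_of_int [simp]: "\<sigma> (of_int n) = of_int n"
  by (cases n) (auto simp: hom_minus simp del: of_nat_Suc)

lemma hom_eq_0_iff: "x \<in> E \<Longrightarrow> \<sigma> x = 0 \<longleftrightarrow> x = 0"
  using hom_mult[of x "inverse x"] by (cases "x = 0") auto

lemma hom_inverse: "x \<in> E \<Longrightarrow> \<sigma> (inverse x) = inverse (\<sigma> x)"
  using hom_mult[of x "inverse x"] by (cases "x = 0") (auto simp: inverse_unique)

lemma hom_divide: "x \<in> E \<Longrightarrow> y \<in> E \<Longrightarrow> \<sigma> (x / y) = \<sigma> x / \<sigma> y"
  by (simp add: divide_inverse hom_mult hom_inverse)

lemma hom_Rats: "x \<in> \<rat> \<Longrightarrow> \<sigma> x = x"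
  by (auto elim!: Rats_cases' simp: hom_divide)

lemma hom_inj: "x \<in> E \<Longrightarrow> y \<in> E \<Longrightarrow> \<sigma> x = \<sigma> y \<longleftrightarrow> x = y"
  using hom_eq_0_iff[of "x - y"] by (simp add: hom_diff)

lemma hom_ieval: "x \<in> E \<Longrightarrow> \<sigma> (ieval g x) = ieval g (\<sigma> x)"
  by (induction g) (auto simp: hom_add hom_mult)

lemma map_poly_hom_mult:
  assumes "\<And>i. coeff P i \<in> E" "\<And>i. coeff Q i \<in> E"
  shows "map_poly \<sigma> (P * Q) = map_poly \<sigma> P * map_poly \<sigma> Q"
  by (rule poly_eqI) (simp add: coeff_map_poly coeff_mult hom_sum hom_mult assms)

lemma map_poly_hom_prod:
  "(\<And>k j. k \<in> I \<Longrightarrow> coeff (f k) j \<in> E) \<Longrightarrow> map_poly \<sigma> (\<Prod>k\<in>I. f k) = (\<Prod>k\<in>I. map_poly \<sigma> (f k))"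
  by (induction I rule: infinite_finite_induct) (auto simp: map_poly_hom_mult coeff_prod_closed)

lemma map_poly_linear: "a \<in> E \<Longrightarrow> map_poly \<sigma> [:- a, 1:] = [:- \<sigma> a, 1:]"
  by (simp add: map_poly_pCons hom_minus)

lemma map_poly_linear_prod:
  "(\<And>k. k \<in> I \<Longrightarrow> f k \<in> E) \<Longrightarrow> map_poly \<sigma> (\<Prod>k\<in>I. [:- f k, 1:]) = (\<Prod>k\<in>I. [:- \<sigma> (f k), 1:])"
  by (subst map_poly_hom_prod) (auto simp: coeff_linear_closed map_poly_linear)

end

text \<open>Induction by the primitive element trick: \<open>\<theta>\<close> is replaced by
  \<open>\<theta> + n * \<beta>\<close>. For each pair the difference of the two images is a nonzero
  linear expression in \<open>n\<close>, so each pair excludes at most one \<open>n\<close>.\<close>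

lemma exists_separating_element:
  fixes E :: "'a::field_char_0 set"
  assumes "finite S"
    and "\<And>\<sigma> \<tau>. (\<sigma>, \<tau>) \<in> S \<Longrightarrow> field_endo E \<sigma> \<and> field_endo E \<tau> \<and> (\<exists>x\<in>E. \<sigma> x \<noteq> \<tau> x)"
    and E: "field_set E"
  shows "\<exists>\<theta>\<in>E. \<forall>(\<sigma>, \<tau>)\<in>S. \<sigma> \<theta> \<noteq> \<tau> \<theta>"
  using assms(1,2)
proof (induction S rule: finite_induct)
  case empty
  then show ?case using field_set.one_closed[OF E] by auto
next
  case (insert s S)
  interpret field_set E by (rule E)
  obtain \<theta> where \<theta>: "\<theta> \<in> E" "\<forall>(\<sigma>, \<tau>)\<in>S. \<sigma> \<theta> \<noteq> \<tau> \<theta>" using insert by blast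
  obtain \<phi> \<psi> where s: "s = (\<phi>, \<psi>)" by (cases s)
  obtain \<beta> where \<beta>: "\<beta> \<in> E" "\<phi> \<beta> \<noteq> \<psi> \<beta>" using insert.prems[of \<phi> \<psi>] s by auto
  define bad :: "('a \<Rightarrow> 'a) \<times> ('a \<Rightarrow> 'a) \<Rightarrow> nat set" where
    "bad = (\<lambda>(\<sigma>, \<tau>). {n::nat. \<sigma> (\<theta> + of_nat n * \<beta>) = \<tau> (\<theta> + of_nat n * \<beta>)})"
  have lin: "\<sigma> (\<theta> + of_nat n * \<beta>) - \<tau> (\<theta> + of_nat n * \<beta>) = (\<sigma> \<theta> - \<tau> \<theta>) + of_nat n * (\<sigma> \<beta> - \<tau> \<beta>)"
    if "(\<sigma>, \<tau>) \<in> insert s S" for \<sigma> \<tau> n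
  proof -
    interpret A: field_endo E \<sigma> using insert.prems that by blast
    interpret B: field_endo E \<tau> using insert.prems that by blast
    show ?thesis using \<theta> \<beta> by (simp add: A.hom_add A.hom_mult B.hom_add B.hom_mult algebra_simps)
  qed
  have "finite (bad r)" if r: "r \<in> insert s S" for r
  proof -
    obtain \<sigma> \<tau> where r': "r = (\<sigma>, \<tau>)" by (cases r)
    have ne: "\<sigma> \<theta> \<noteq> \<tau> \<theta> \<or> \<sigma> \<beta> \<noteq> \<tau> \<beta>" using r r' s \<theta>(2) \<beta>(2) by auto
    have "n = m" if "n \<in> bad r" "m \<in> bad r" for n m
    proof -
      have eqs: "(\<sigma> \<theta> - \<tau> \<theta>) + of_nat n * (\<sigma> \<beta> - \<tau> \<beta>) = 0"
        "(\<sigma> \<theta> - \<tau> \<theta>) + of_nat m * (\<sigma> \<beta> - \<tau> \<beta>) = 0"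
        using lin[of \<sigma> \<tau> n] lin[of \<sigma> \<tau> m] that r r' by (auto simp: bad_def)
      then have "\<sigma> \<beta> - \<tau> \<beta> \<noteq> 0" using ne by auto
      moreover have "(of_nat n - of_nat m) * (\<sigma> \<beta> - \<tau> \<beta>)
          = ((\<sigma> \<theta> - \<tau> \<theta>) + of_nat n * (\<sigma> \<beta> - \<tau> \<beta>)) - ((\<sigma> \<theta> - \<tau> \<theta>) + of_nat m * (\<sigma> \<beta> - \<tau> \<beta>))"
        by (simp add: algebra_simps)
      ultimately show ?thesis unfolding eqs by simp
    qed
    then have "bad r = {} \<or> (\<exists>n. bad r = {n})" by blast
    then show ?thesis by auto
  qed
  then have "finite (\<Union>r\<in>insert s S. bad r)" using insert by blast
  then obtain n where n: "n \<notin> (\<Union>r\<in>insert s S. bad r)"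
    using ex_new_if_finite[OF infinite_UNIV_nat] by blast
  show ?case
    using n \<theta> \<beta> by (intro bexI[of _ "\<theta> + of_nat n * \<beta>"]) (auto simp: bad_def)
qed

text \<open>An abstract finite Galois group, to be instantiated for both \<open>F\<close> and
  \<open>L\<close>. Composition and identity are asked for only up to agreement on \<open>E\<close>,
  because the actual group consists of restricted functions.\<close>

locale galois_over_Rats = field_set E for E :: "'a::field_char_0 set" +
  fixes G :: "('a \<Rightarrow> 'a) set"
  assumes finite_G: "finite G"
    and endo: "\<sigma> \<in> G \<Longrightarrow> field_endo E \<sigma>"
    and compose_closed: "\<sigma> \<in> G \<Longrightarrow> \<tau> \<in> G \<Longrightarrow> \<exists>\<rho>\<in>G. \<forall>x\<in>E. \<rho> x = \<sigma> (\<tau> x)"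
    and ext: "\<sigma> \<in> G \<Longrightarrow> \<tau> \<in> G \<Longrightarrow> (\<And>x. x \<in> E \<Longrightarrow> \<sigma> x = \<tau> x) \<Longrightarrow> \<sigma> = \<tau>"
    and id_closed: "\<exists>\<iota>\<in>G. \<forall>x\<in>E. \<iota> x = x"
    and fixed_Rats: "x \<in> E \<Longrightarrow> (\<And>\<sigma>. \<sigma> \<in> G \<Longrightarrow> \<sigma> x = x) \<Longrightarrow> x \<in> \<rat>"
begin

text \<open>Left multiplication by \<open>\<sigma>\<close> is injective on a finite set, hence a
  permutation. It serves to show that symmetric expressions in the conjugates are rational.\<close>

lemma left_translation:
  assumes "\<sigma> \<in> G"
  obtains m where "bij_betw m G G" "\<And>\<rho> x. \<rho> \<in> G \<Longrightarrow> x \<in> E \<Longrightarrow> m \<rho> x = \<sigma> (\<rho> x)"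
proof -
  obtain m where m: "\<And>\<rho>. \<rho> \<in> G \<Longrightarrow> m \<rho> \<in> G \<and> (\<forall>x\<in>E. m \<rho> x = \<sigma> (\<rho> x))"
    using compose_closed[OF assms] by metis
  have "inj_on m G"
  proof (rule inj_onI)
    fix \<rho> \<rho>' assume G: "\<rho> \<in> G" "\<rho>' \<in> G" and eq: "m \<rho> = m \<rho>'"
    interpret S: field_endo E \<sigma> using endo assms .
    interpret R: field_endo E \<rho> using endo G(1) .
    interpret R': field_endo E \<rho>' using endo G(2) .
    show "\<rho> = \<rho>'"
      using G m[OF G(1)] m[OF G(2)] eq by (intro ext) (auto simp: S.hom_inj)
  qed
  moreover have "m ` G \<subseteq> G" using m by blast
  ultimately have "bij_betw m G G"
    using finite_G by (simp add: bij_betw_def endo_inj_surj)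
  with m that show ?thesis by blast
qed

lemma rational_coeffs:
  assumes "\<And>i. coeff P i \<in> E" "\<And>\<sigma>. \<sigma> \<in> G \<Longrightarrow> map_poly \<sigma> P = P"
  shows "coeff P i \<in> \<rat>"
proof (rule fixed_Rats)
  fix \<sigma> assume "\<sigma> \<in> G"
  then interpret field_endo E \<sigma> by (rule endo)
  show "\<sigma> (coeff P i) = coeff P i"
    using assms(2)[OF \<open>\<sigma> \<in> G\<close>] by (metis coeff_map_poly hom_0)
qed (rule assms)

definition conjugate_poly :: "'a \<Rightarrow> 'a poly" where
  "conjugate_poly \<theta> = (\<Prod>\<rho>\<in>G. [:- \<rho> \<theta>, 1:])"

text \<open>Lagrange interpolation through the points \<open>(\<rho> \<theta>, \<rho> y)\<close>,
  with the denominators left out. Its value at \<open>\<theta>\<close> is \<open>y\<close> times a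
  factor that does not depend on \<open>y\<close>.\<close>

definition interpolation_poly :: "'a \<Rightarrow> 'a \<Rightarrow> 'a poly" where
  "interpolation_poly \<theta> y = (\<Sum>\<rho>\<in>G. smult (\<rho> y) (\<Prod>\<kappa>\<in>G - {\<rho>}. [:- \<kappa> \<theta>, 1:]))"

lemma conjugate_closed: "\<rho> \<in> G \<Longrightarrow> x \<in> E \<Longrightarrow> \<rho> x \<in> E"
  using endo field_endo.maps by blast

lemma conjugate_poly_rational:
  assumes "\<theta> \<in> E" shows "coeff (conjugate_poly \<theta>) i \<in> \<rat>"
proof (rule rational_coeffs)
  show "coeff (conjugate_poly \<theta>) i \<in> E" for i
    unfolding conjugate_poly_def
    by (intro coeff_prod_closed coeff_linear_closed) (rule conjugate_closed[OF _ assms])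
next
  fix \<sigma> assume \<sigma>: "\<sigma> \<in> G"
  then interpret S: field_endo E \<sigma> by (rule endo)
  obtain m where m: "bij_betw m G G" "\<And>\<rho> x. \<rho> \<in> G \<Longrightarrow> x \<in> E \<Longrightarrow> m \<rho> x = \<sigma> (\<rho> x)"
    using left_translation[OF \<sigma>] by blast
  have "map_poly \<sigma> (conjugate_poly \<theta>) = (\<Prod>\<rho>\<in>G. [:- \<sigma> (\<rho> \<theta>), 1:])"
    unfolding conjugate_poly_def by (rule S.map_poly_linear_prod) (rule conjugate_closed[OF _ assms])
  also have "\<dots> = (\<Prod>\<rho>\<in>G. [:- m \<rho> \<theta>, 1:])"
    using assms m(2) by (intro prod.cong) auto
  also have "\<dots> = conjugate_poly \<theta>"
    unfolding conjugate_poly_def by (rule prod.reindex_bij_betw[OF m(1)])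
  finally show "map_poly \<sigma> (conjugate_poly \<theta>) = conjugate_poly \<theta>" .
qed

lemma interpolation_poly_rational:
  assumes "\<theta> \<in> E" "y \<in> E" shows "coeff (interpolation_poly \<theta> y) i \<in> \<rat>"
proof (rule rational_coeffs)
  have cE: "coeff (\<Prod>\<kappa>\<in>I. [:- \<kappa> \<theta>, 1:]) i \<in> E" if "I \<subseteq> G" for I i
    using that by (intro coeff_prod_closed coeff_linear_closed) (auto intro: conjugate_closed[OF _ assms(1)])
  show "coeff (interpolation_poly \<theta> y) i \<in> E" for i
    unfolding interpolation_poly_def coeff_sum coeff_smult
    by (rule sum_closed, rule mult_closed, erule conjugate_closed[OF _ assms(2)], rule cE) auto
  fix \<sigma> assume \<sigma>: "\<sigma> \<in> G"
  then interpret S: field_endo E \<sigma> by (rule endo)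
  obtain m where m: "bij_betw m G G" "\<And>\<rho> x. \<rho> \<in> G \<Longrightarrow> x \<in> E \<Longrightarrow> m \<rho> x = \<sigma> (\<rho> x)"
    using left_translation[OF \<sigma>] by blast
  have mG: "bij_betw m (G - {\<rho>}) (G - {m \<rho>})" if "\<rho> \<in> G" for \<rho>
    using m(1) that by (intro bij_betw_DiffI) (auto simp: bij_betw_def)
  have "map_poly \<sigma> (interpolation_poly \<theta> y)
      = (\<Sum>\<rho>\<in>G. smult (\<sigma> (\<rho> y)) (map_poly \<sigma> (\<Prod>\<kappa>\<in>G - {\<rho>}. [:- \<kappa> \<theta>, 1:])))"
    unfolding interpolation_poly_def
    by (rule poly_eqI)
      (simp add: coeff_map_poly coeff_sum S.hom_sum S.hom_mult cE conjugate_closed[OF _ assms(2)])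
  also have "\<dots> = (\<Sum>\<rho>\<in>G. smult (m \<rho> y) (\<Prod>\<kappa>\<in>G - {m \<rho>}. [:- \<kappa> \<theta>, 1:]))"
  proof (rule sum.cong)
    fix \<rho> assume "\<rho> \<in> G"
    have "map_poly \<sigma> (\<Prod>\<kappa>\<in>G - {\<rho>}. [:- \<kappa> \<theta>, 1:]) = (\<Prod>\<kappa>\<in>G - {\<rho>}. [:- \<sigma> (\<kappa> \<theta>), 1:])"
      by (rule S.map_poly_linear_prod) (auto intro: conjugate_closed[OF _ assms(1)])
    also have "\<dots> = (\<Prod>\<kappa>\<in>G - {\<rho>}. [:- m \<kappa> \<theta>, 1:])"
      using assms m(2) by (intro prod.cong) auto
    also have "\<dots> = (\<Prod>\<kappa>\<in>G - {m \<rho>}. [:- \<kappa> \<theta>, 1:])"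
      by (rule prod.reindex_bij_betw[OF mG[OF \<open>\<rho> \<in> G\<close>]])
    finally show "smult (\<sigma> (\<rho> y)) (map_poly \<sigma> (\<Prod>\<kappa>\<in>G - {\<rho>}. [:- \<kappa> \<theta>, 1:]))
      = smult (m \<rho> y) (\<Prod>\<kappa>\<in>G - {m \<rho>}. [:- \<kappa> \<theta>, 1:])"
      using m(2) \<open>\<rho> \<in> G\<close> assms by simp
  qed simp
  also have "\<dots> = interpolation_poly \<theta> y"
    unfolding interpolation_poly_def by (rule sum.reindex_bij_betw[OF m(1)])
  finally show "map_poly \<sigma> (interpolation_poly \<theta> y) = interpolation_poly \<theta> y" .
qed

end

section \<open>An unramified valuation of degree one\<close>

lemma ieval_pderiv: "ieval (pderiv g) x = poly (pderiv (map_poly of_int g)) x"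
  by (induction g) (auto simp: pderiv_pCons map_poly_pCons ieval_def[of g for g, symmetric])

context galois_over_Rats
begin

lemma exists_distinct_conjugates:
  obtains \<theta> where "\<theta> \<in> E" "inj_on (\<lambda>\<rho>. \<rho> \<theta>) G"
proof -
  define S where "S = {(\<sigma>, \<tau>). \<sigma> \<in> G \<and> \<tau> \<in> G \<and> \<sigma> \<noteq> \<tau>}"
  have "S \<subseteq> G \<times> G" by (auto simp: S_def)
  then have "finite S" using finite_G finite_subset by blast
  then have "\<exists>\<theta>\<in>E. \<forall>(\<sigma>, \<tau>)\<in>S. \<sigma> \<theta> \<noteq> \<tau> \<theta>"
    using ext endo field_set_axioms
    by (intro exists_separating_element) (auto simp: S_def, blast)
  then obtain \<theta> where "\<theta> \<in> E" "\<forall>(\<sigma>, \<tau>)\<in>S. \<sigma> \<theta> \<noteq> \<tau> \<theta>" by blast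
  then show ?thesis by (intro that[of \<theta>]) (auto simp: S_def inj_on_def)
qed

lemma degree_conjugate_poly: "degree (conjugate_poly \<theta>) = card G"
  unfolding conjugate_poly_def by (subst degree_prod_eq_sum_degree) auto

lemma monic_conjugate_poly: "lead_coeff (conjugate_poly \<theta>) = 1"
  unfolding conjugate_poly_def by (subst lead_coeff_prod) auto

lemma poly_conjugate_poly: "poly (conjugate_poly \<theta>) x = (\<Prod>\<rho>\<in>G. x - \<rho> \<theta>)"
  unfolding conjugate_poly_def by (simp add: poly_prod)

lemma ieval_vanishes_on_conjugates:
  assumes "\<theta> \<in> E" "ieval g \<theta> = 0" "\<rho> \<in> G"
  shows "ieval g (\<rho> \<theta>) = 0"
proof -
  interpret field_endo E \<rho> by (rule endo) fact
  show ?thesis using hom_ieval[of \<theta> g] assms by simp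
qed

text \<open>The conjugates of \<open>\<theta>\<close> are \<open>card G\<close> distinct roots of
  \<open>r\<close>. Applied to remainders, this shows that integer polynomials vanishing at
  \<open>\<theta>\<close> are multiples of the conjugate polynomial up to a constant.\<close>

lemma few_roots_imp_zero:
  assumes "\<theta> \<in> E" "inj_on (\<lambda>\<rho>. \<rho> \<theta>) G" "ieval r \<theta> = 0" "degree r < card G"
  shows "r = 0"
proof (rule ccontr)
  assume "r \<noteq> 0"
  define R where "R = (map_poly of_int r :: 'a poly)"
  have "R \<noteq> 0" "degree R = degree r"
    using \<open>r \<noteq> 0\<close> by (auto simp: R_def degree_map_poly map_poly_eq_0_iff)
  moreover have "(\<lambda>\<rho>. \<rho> \<theta>) ` G \<subseteq> {x. poly R x = 0}"
    using ieval_vanishes_on_conjugates[OF assms(1,3)] by (auto simp: R_def ieval_def)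
  then have "card G \<le> card {x. poly R x = 0}"
    using card_mono[OF poly_roots_finite[OF \<open>R \<noteq> 0\<close>]] card_image[OF assms(2)] by metis
  ultimately show False using card_poly_roots_bound[OF \<open>R \<noteq> 0\<close>] assms(4) by linarith
qed

lemma poly_pderiv_conjugate_poly:
  assumes "\<theta> \<in> E" "inj_on (\<lambda>\<rho>. \<rho> \<theta>) G"
  shows "poly (pderiv (conjugate_poly \<theta>)) \<theta> \<noteq> 0"
proof -
  obtain \<iota> where \<iota>: "\<iota> \<in> G" "\<forall>x\<in>E. \<iota> x = x" using id_closed by blast
  define N where "N = (\<Prod>\<rho>\<in>G - {\<iota>}. [:- \<rho> \<theta>, 1:])"
  have "conjugate_poly \<theta> = [:- \<theta>, 1:] * N"
    unfolding conjugate_poly_def N_def using \<iota> assms(1) finite_G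
    by (subst prod.remove[OF finite_G \<iota>(1)]) simp
  then have "poly (pderiv (conjugate_poly \<theta>)) \<theta> = poly N \<theta>"
    by (simp add: pderiv_mult pderiv_pCons del: mult_pCons_left)
  also have "\<dots> = (\<Prod>\<rho>\<in>G - {\<iota>}. \<theta> - \<rho> \<theta>)" by (simp add: N_def poly_prod)
  also have "\<dots> \<noteq> 0"
    using assms \<iota> finite_G by (auto simp: inj_on_def prod_zero_iff)
  finally show ?thesis .
qed

text \<open>The interpolation polynomials of \<open>y\<close> and of 1 take the values
  \<open>y * c\<close> and \<open>c\<close> at \<open>\<theta>\<close>, so their quotient is
  \<open>y\<close>; clearing denominators makes both integral.\<close>

lemma quotient_representation:
  assumes "\<theta> \<in> E" "inj_on (\<lambda>\<rho>. \<rho> \<theta>) G" "y \<in> E"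
  shows "\<exists>a b. ieval b \<theta> \<noteq> 0 \<and> y * ieval b \<theta> = ieval a \<theta>"
proof -
  obtain \<iota> where \<iota>: "\<iota> \<in> G" "\<forall>x\<in>E. \<iota> x = x" using id_closed by blast
  define c where "c = (\<Prod>\<kappa>\<in>G - {\<iota>}. \<theta> - \<kappa> \<theta>)"
  have "c \<noteq> 0"
    using assms \<iota> finite_G by (auto simp: inj_on_def prod_zero_iff c_def)
  have val: "poly (interpolation_poly \<theta> z) \<theta> = z * c" if "z \<in> E" for z
  proof -
    have "poly (interpolation_poly \<theta> z) \<theta> = (\<Sum>\<rho>\<in>G. \<rho> z * (\<Prod>\<kappa>\<in>G - {\<rho>}. \<theta> - \<kappa> \<theta>))"
      by (simp add: interpolation_poly_def poly_sum poly_prod)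
    also have "\<dots> = \<iota> z * c + (\<Sum>\<rho>\<in>G - {\<iota>}. \<rho> z * (\<Prod>\<kappa>\<in>G - {\<rho>}. \<theta> - \<kappa> \<theta>))"
      unfolding c_def using finite_G \<iota>(1) by (subst sum.remove) auto
    also have "(\<Sum>\<rho>\<in>G - {\<iota>}. \<rho> z * (\<Prod>\<kappa>\<in>G - {\<rho>}. \<theta> - \<kappa> \<theta>)) = 0"
    proof (intro sum.neutral ballI)
      fix \<rho> assume "\<rho> \<in> G - {\<iota>}"
      then have "(\<Prod>\<kappa>\<in>G - {\<rho>}. \<theta> - \<kappa> \<theta>) = 0"
        using finite_G \<iota> assms(1) by (intro prod_zero bexI[of _ \<iota>]) auto
      then show "\<rho> z * (\<Prod>\<kappa>\<in>G - {\<rho>}. \<theta> - \<kappa> \<theta>) = 0" by simp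
    qed
    finally show ?thesis using \<iota> that by simp
  qed
  obtain D1 g where g: "D1 > 0" "smult (of_int D1) (interpolation_poly \<theta> y) = map_poly of_int g"
    using rat_poly_clear_denominators[OF interpolation_poly_rational[OF assms(1,3)]] by blast
  obtain D2 h where h: "D2 > 0" "smult (of_int D2) (interpolation_poly \<theta> 1) = map_poly of_int h"
    using rat_poly_clear_denominators[OF interpolation_poly_rational[OF assms(1) one_closed]] by blast
  have "ieval g \<theta> = of_int D1 * (y * c)" "ieval h \<theta> = of_int D2 * c"
    by (simp_all add: ieval_def flip: g(2) h(2) add: val assms(3))
  then show ?thesis using \<open>c \<noteq> 0\<close> g(1) h(1)
    by (intro exI[of _ "smult D1 h"] exI[of _ "smult D2 g"]) simp
qed

text \<open>The valuation belongs to an unramified prime of degree one: it comes from a prime number that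
  divides a value of the minimal polynomial of a primitive element exactly once.\<close>

theorem exists_valuation:
  assumes alg: "\<And>x. x \<in> E \<Longrightarrow> algebraic x"
  obtains v :: "'a \<Rightarrow> int" and x
  where "\<And>x y. x \<in> E - {0} \<Longrightarrow> y \<in> E - {0} \<Longrightarrow> v (x * y) = v x + v y"
    and "x \<in> E - {0}" "\<And>\<sigma>. \<sigma> \<in> G \<Longrightarrow> v (\<sigma> x) \<ge> 0" "(\<Sum>\<sigma>\<in>G. v (\<sigma> x)) = 1"
proof -
  obtain \<theta> where \<theta>: "\<theta> \<in> E" "inj_on (\<lambda>\<rho>. \<rho> \<theta>) G" by (rule exists_distinct_conjugates)
  define M0 where "M0 = conjugate_poly \<theta>"
  obtain D M where DM: "D > 0" "smult (of_int D) M0 = map_poly of_int M"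
    using rat_poly_clear_denominators[OF conjugate_poly_rational[OF \<theta>(1)]] by (auto simp: M0_def)
  have evM: "ieval M x = of_int D * (\<Prod>\<rho>\<in>G. x - \<rho> \<theta>)" for x
    by (simp add: ieval_def M0_def poly_conjugate_poly flip: DM(2))
  have "degree M = degree (map_poly of_int M :: 'a poly)" by (simp add: degree_map_poly)
  also have "\<dots> = card G" using DM(1) by (simp add: M0_def degree_conjugate_poly flip: DM(2))
  finally have degM: "degree M = card G" .
  have "of_int (lead_coeff M) = lead_coeff (map_poly of_int M :: 'a poly)"
    by (simp add: degree_map_poly coeff_map_poly)
  also have "\<dots> = of_int D" by (simp add: M0_def monic_conjugate_poly flip: DM(2))
  finally have leadM: "lead_coeff M = D" by simp
  obtain \<iota> where \<iota>: "\<iota> \<in> G" "\<forall>x\<in>E. \<iota> x = x" using id_closed by blast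
  have "card G > 0" using \<iota> finite_G card_gt_0_iff by blast
  have rootM: "ieval M \<theta> = 0"
    using \<iota> \<theta>(1) finite_G by (auto simp: evM prod_zero_iff intro!: bexI[of _ \<iota>])
  have "ieval (pderiv M) \<theta> \<noteq> 0"
    using poly_pderiv_conjugate_poly[OF \<theta>] DM(1)
    by (simp add: ieval_pderiv pderiv_smult M0_def flip: DM(2))
  then obtain P where P: "coeff P 0 \<noteq> 0" "ieval P (ieval (pderiv M) \<theta>) = 0"
    using algebraicE'_nonzero[OF alg] \<theta>(1) unfolding ieval_def by (metis ieval_closed ieval_def)
  \<comment> \<open>Avoiding \<open>D\<close>, the leading coefficient of \<open>M\<close>, permits
    division by \<open>M\<close> modulo \<open>q\<close>. Avoiding the constant term of
    \<open>P\<close> makes the root simple: a derivative divisible by \<open>q\<close> would,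
    through the reduction of the relation given by \<open>P\<close>, force \<open>q\<close> to
    divide that term.\<close>
  obtain q t0 where q: "prime q" "\<not> q dvd D * coeff P 0" "q dvd poly M t0"
    using exists_prime_divisor_of_value[of M "D * coeff P 0"] degM \<open>card G > 0\<close> DM(1) P(1)
    by auto
  have qD: "\<not> q dvd D" "\<not> q dvd coeff P 0" using q(2) by auto
  \<comment> \<open>Pseudo-division by \<open>M\<close> leaves a remainder that vanishes at
    \<open>\<theta>\<close> and has too small a degree, hence is 0. The factor it introduces is a
    power of \<open>D\<close>, which is prime to \<open>q\<close>.\<close>
  have reduction: "q dvd poly g t" if "q dvd poly M t" "ieval g \<theta> = 0" for g t
  proof -
    obtain h r where hr: "pseudo_divmod g M = (h, r)" by fastforce
    have "M \<noteq> 0" using degM \<open>card G > 0\<close> by auto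
    note pd = pseudo_divmod[OF this hr]
    have "ieval (smult (lead_coeff M ^ (Suc (degree g) - degree M)) g) \<theta> = ieval (M * h + r) \<theta>"
      by (simp only: pd(1))
    then have "ieval r \<theta> = 0" using that rootM by simp
    moreover have "degree r < card G" using pd(2) degM \<open>card G > 0\<close> by auto
    ultimately have "r = 0" using few_roots_imp_zero \<theta> by blast
    have "poly (smult (lead_coeff M ^ (Suc (degree g) - degree M)) g) t = poly (M * h + r) t"
      by (simp only: pd(1))
    then have "D ^ (Suc (degree g) - degree M) * poly g t = poly M t * poly h t"
      using leadM \<open>r = 0\<close> by simp
    then have "q dvd D ^ (Suc (degree g) - degree M) * poly g t" using that by simp
    then show ?thesis using q(1) qD(1) prime_dvd_power by (auto simp: prime_dvd_mult_iff)
  qed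
  have "\<not> q dvd poly (pderiv M) t0"
  proof
    assume "q dvd poly (pderiv M) t0"
    have "q dvd poly P (poly (pderiv M) t0)"
      using reduction[OF q(3), of "pcompose P (pderiv M)"] P(2) by (simp add: poly_pcompose)
    moreover have "q dvd poly P (poly (pderiv M) t0) - poly P 0"
      using \<open>q dvd poly (pderiv M) t0\<close> by (intro cong_poly_int) simp
    ultimately have "q dvd poly P 0" by (metis dvd_diff_right_iff)
    then show False using qD(2) by (simp add: poly_0_coeff_0)
  qed
  from exact_prime_divisor_of_value[OF q(3) this q(1)]
  obtain t where t: "q dvd t - t0" "q dvd poly M t" "\<not> q\<^sup>2 dvd poly M t" by blast
  have simple: "\<not> q dvd poly (pderiv M) t"
    using cong_poly_int[OF t(1), of "pderiv M"] \<open>\<not> q dvd poly (pderiv M) t0\<close> by (metis dvd_diff_right_iff)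
  interpret V: simple_residue_root \<theta> M q t
    using q(1) rootM t(2) simple reduction[OF t(2)] alg \<theta>(1) by unfold_locales auto
  have fraction: "V.fraction y" if "y \<in> E" for y
    using quotient_representation[OF \<theta> that] unfolding V.fraction_def .
  \<comment> \<open>Up to sign the norm of this element is \<open>poly M t / D\<close>, and
    \<open>q\<close> divides that exactly once by the choice of \<open>t\<close>.\<close>
  define x where "x = \<theta> - of_int t"
  have \<sigma>x: "\<sigma> x = \<sigma> \<theta> - of_int t" "\<sigma> x \<in> E" if "\<sigma> \<in> G" for \<sigma>
  proof -
    interpret field_endo E \<sigma> by (rule endo) fact
    show "\<sigma> x = \<sigma> \<theta> - of_int t" "\<sigma> x \<in> E" using \<theta>(1) by (simp_all add: x_def hom_diff)
  qed
  have "of_int (poly M t) = of_int D * (\<Prod>\<rho>\<in>G. of_int t - \<rho> \<theta>)"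
    using evM[of "of_int t"] by simp
  also have "(\<Prod>\<rho>\<in>G. of_int t - \<rho> \<theta>) = (\<Prod>\<rho>\<in>G. - \<rho> x)"
    by (intro prod.cong) (auto simp: \<sigma>x)
  also have "\<dots> = (-1) ^ card G * (\<Prod>\<rho>\<in>G. \<rho> x)" by (simp add: prod_uminus)
  finally have norm: "of_int (poly M t) = of_int ((-1) ^ card G * D) * (\<Prod>\<rho>\<in>G. \<rho> x)" by simp
  have "poly M t \<noteq> 0" using t(3) by auto
  then have "(\<Prod>\<rho>\<in>G. \<rho> x) \<noteq> 0" using norm by (metis mult_zero_right of_int_eq_0_iff)
  then have nz: "\<rho> x \<noteq> 0" if "\<rho> \<in> G" for \<rho> using finite_G that by (auto simp: prod_zero_iff)
  obtain s where s: "poly M t = q * s" using t(2) by blast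
  have "\<not> q dvd s" using t(3) q(1) by (auto simp: s power2_eq_square)
  define u where "u = (of_int s / of_int ((-1) ^ card G * D) :: 'a)"
  have "\<not> q dvd (-1) ^ card G * D" using qD(1) by (cases "even (card G)") auto
  then have "V.local_unit u"
    unfolding u_def using \<open>\<not> q dvd s\<close> by (intro V.local_unit_divide V.local_unit_of_int)
  have "(\<Prod>\<rho>\<in>G. \<rho> x) = of_int q * u"
    using norm DM(1) by (simp add: s u_def field_simps)
  then have val_norm: "V.val (\<Prod>\<rho>\<in>G. \<rho> x) = 1"
    using V.val_q_times_local_unit[OF \<open>V.local_unit u\<close>] by simp
  have mult: "V.val (a * b) = V.val a + V.val b" if "a \<in> E - {0}" "b \<in> E - {0}" for a b
    using that fraction by (intro V.val_mult) auto
  have val_prod: "V.val (\<Prod>\<rho>\<in>I. \<rho> x) = (\<Sum>\<rho>\<in>I. V.val (\<rho> x))" if "I \<subseteq> G" for I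
    using finite_subset[OF that finite_G] that
  proof (induction I rule: finite_induct)
    case empty
    have "V.local_unit 1" using V.local_unit_of_int[of 1] q(1) not_prime_unit by force
    then show ?case using V.val_local_unit by simp
  next
    case (insert \<rho> I)
    have "(\<Prod>\<rho>\<in>I. \<rho> x) \<in> E" using insert.prems \<sigma>x(2) by (intro prod_closed) auto
    moreover have "(\<Prod>\<rho>\<in>I. \<rho> x) \<noteq> 0" using insert nz by (auto simp: prod_zero_iff)
    ultimately show ?case using insert nz \<sigma>x(2) by (simp add: mult)
  qed
  \<comment> \<open>The conjugates of \<open>x\<close> are roots of \<open>M\<close> shifted by
    \<open>t\<close>, whose leading coefficient is still \<open>D\<close>.\<close>
  have "V.val (\<sigma> x) \<ge> 0" if "\<sigma> \<in> G" for \<sigma>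
  proof (rule V.val_nonneg)
    have "ieval M (\<sigma> \<theta>) = 0" using ieval_vanishes_on_conjugates \<theta>(1) rootM that by blast
    then show "ieval (pcompose M [:t, 1:]) (\<sigma> x) = 0" using that by (simp add: \<sigma>x)
    show "\<not> q dvd lead_coeff (pcompose M [:t, 1:])"
      using leadM qD(1) by (subst lead_coeff_comp) auto
  qed (use that fraction \<sigma>x nz in auto)
  moreover have "x \<in> E - {0}" using nz[OF \<iota>(1)] \<sigma>x[OF \<iota>(1)] \<iota> \<theta>(1) by (auto simp: x_def)
  ultimately show ?thesis
    using mult val_norm val_prod[of G] by (intro that[of V.val x]) auto
qed

end

section \<open>Galois groups in an ambient field\<close>

interpretation ambient: ring "ambient :: 'a::field ring"
  by (rule ring_from_type_algebra)

lemmas ambient_field = field_from_type_algebra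

lemma ambient_simps [simp]:
  "carrier (ambient :: 'a::field ring) = UNIV"
  "x \<oplus>\<^bsub>ambient\<^esub> y = x + (y :: 'a)" "x \<otimes>\<^bsub>ambient\<^esub> y = x * (y :: 'a)"
  "\<zero>\<^bsub>ambient\<^esub> = (0 :: 'a)" "\<one>\<^bsub>ambient\<^esub> = (1 :: 'a)"
  by (simp_all add: ring_of_type_algebra_def)

lemma ambient_uminus [simp]: "\<ominus>\<^bsub>ambient\<^esub> x = - (x :: 'a::field)"
  using ambient.minus_equality[of "- x" x] by simp

lemma ambient_inverse [simp]: "x \<noteq> 0 \<Longrightarrow> inv\<^bsub>ambient\<^esub> x = inverse (x :: 'a::field)"
  using ambient.inv_char[of x "inverse x"] by simp

lemma subfield_iff_field_set: "subfield E (ambient :: 'a::field_char_0 ring) \<longleftrightarrow> field_set E"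
proof
  assume E: "subfield E ambient"
  note R = subringE[OF subfieldE(1)[OF E]]
  show "field_set E"
  proof
    fix x assume "x \<in> E"
    then show "inverse x \<in> E"
      using ambient.subfield_m_inv(1)[OF E, of x] R(2) by (cases "x = 0") auto
  qed (use R in auto)
next
  assume "field_set E"
  then interpret field_set E .
  show "subfield E ambient"
    by (intro field.subfieldI'[OF ambient_field] ambient.subringI) auto
qed

lemma field_set_generate: "field_set (generate_field ambient S)"
  using field.generate_field_is_subfield[OF ambient_field, of S] by (simp add: subfield_iff_field_set)

lemma generate_field_minimal: "field_set E \<Longrightarrow> S \<subseteq> E \<Longrightarrow> generate_field ambient S \<subseteq> E"
  using field.generate_field_min_subfield1[OF ambient_field, of S E] by (simp add: subfield_iff_field_set)

lemma generate_field_contains: "S \<subseteq> generate_field ambient S"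
  by (intro subsetI generate_field.incl)

lemma mem_galois_group_iff:
  assumes "field_set L"
  shows "\<sigma> \<in> carrier (galois_group L K) \<longleftrightarrow>
    \<sigma> \<in> extensional L \<and> bij_betw \<sigma> L L \<and> field_endo L \<sigma> \<and> (\<forall>x\<in>K. \<sigma> x = x)"
proof -
  interpret field_set L by fact
  have "field_endo L \<sigma>" if "\<sigma> \<in> Bij L" "\<sigma> \<in> ring_hom (ambient\<lparr>carrier := L\<rparr>) (ambient\<lparr>carrier := L\<rparr>)"
    using that by unfold_locales (auto simp: ring_hom_def)
  moreover have "\<sigma> \<in> ring_hom (ambient\<lparr>carrier := L\<rparr>) (ambient\<lparr>carrier := L\<rparr>)" if "field_endo L \<sigma>"
  proof -
    interpret field_endo L \<sigma> by fact
    show ?thesis by (auto simp: ring_hom_def hom_add hom_mult)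
  qed
  ultimately show ?thesis by (auto simp: galois_group_def Bij_def)
qed

lemma galois_group_eqI:
  assumes "field_set L" "\<sigma> \<in> carrier (galois_group L K)" "\<tau> \<in> carrier (galois_group L K')"
    and "\<And>x. x \<in> L \<Longrightarrow> \<sigma> x = \<tau> x"
  shows "\<sigma> = \<tau>"
  using assms by (auto simp: mem_galois_group_iff intro: extensionalityI)

lemma galois_group_id:
  assumes "field_set L" "K \<subseteq> L" shows "restrict id L \<in> carrier (galois_group L K)"
proof -
  interpret field_set L by fact
  have "field_endo L (restrict id L)" by unfold_locales auto
  then show ?thesis using assms
    by (auto simp: mem_galois_group_iff bij_betw_def inj_on_def)
qed

lemma galois_group_compose:
  assumes L: "field_set L" "K \<subseteq> L"
    and "\<sigma> \<in> carrier (galois_group L K)" "\<tau> \<in> carrier (galois_group L K)"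
  shows "compose L \<sigma> \<tau> \<in> carrier (galois_group L K)"
proof -
  interpret S: field_endo L \<sigma> using assms by (simp add: mem_galois_group_iff)
  interpret T: field_endo L \<tau> using assms by (simp add: mem_galois_group_iff)
  have "field_endo L (compose L \<sigma> \<tau>)"
    by unfold_locales (auto simp: compose_def S.hom_add S.hom_mult T.hom_add T.hom_mult)
  then show ?thesis using assms bij_betw_compose[of \<tau> L L \<sigma> L]
    by (auto simp: mem_galois_group_iff compose_def)
qed

lemma galois_group_inverse:
  assumes L: "field_set L" "K \<subseteq> L" and \<sigma>: "\<sigma> \<in> carrier (galois_group L K)"
  shows "\<exists>\<tau>\<in>carrier (galois_group L K). \<forall>x\<in>L. \<tau> (\<sigma> x) = x \<and> \<sigma> (\<tau> x) = x"
proof -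
  interpret S: field_endo L \<sigma> using assms by (simp add: mem_galois_group_iff)
  have bij: "bij_betw \<sigma> L L" using assms by (simp add: mem_galois_group_iff)
  define \<tau> where "\<tau> = restrict (inv_into L \<sigma>) L"
  have \<tau>: "\<tau> (\<sigma> x) = x" "\<sigma> (\<tau> x) = x" "\<tau> x \<in> L" if "x \<in> L" for x
    using that bij by (auto simp: \<tau>_def bij_betw_def inv_into_into f_inv_into_f)
  have eq: "\<tau> y = x" if "x \<in> L" "\<sigma> x = y" for x y using that \<tau>(1) by auto
  have "field_endo L \<tau>"
    by unfold_locales (auto intro!: eq simp: \<tau> S.hom_add S.hom_mult)
  moreover have "bij_betw \<tau> L L"
    unfolding \<tau>_def using bij_betw_inv_into[OF bij] by (simp add: bij_betw_restrict_eq)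
  moreover have "\<tau> x = x" if "x \<in> K" for x
    using that assms by (intro eq) (auto simp: mem_galois_group_iff)
  ultimately have "\<tau> \<in> carrier (galois_group L K)"
    using L by (auto simp: mem_galois_group_iff \<tau>_def)
  then show ?thesis using \<tau> by blast
qed

lemma Rats_field_set: "field_set \<rat>"
  by unfold_locales auto

lemma ambient_Span_Nil [simp]: "ambient.Span K [] = {0}"
  by simp

lemma ambient_Span_Cons: "x \<in> ambient.Span K (u # Vs) \<longleftrightarrow> (\<exists>k\<in>K. \<exists>v\<in>ambient.Span K Vs. x = k * u + v)"
  by (simp add: ambient.line_extension_mem_iff)

declare ambient.Span.simps [simp del]

text \<open>An automorphism is determined by its values on a finite spanning family, and each value
  is a root of a fixed nonzero polynomial.\<close>

lemma finite_galois_group: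
  assumes alg: "\<And>z. z \<in> F \<Longrightarrow> algebraic z"
    and F: "field_set (F :: 'a::field_char_0 set)" and dim: "ambient.finite_dimension \<rat> F"
  shows "finite (carrier (galois_group F \<rat>))"
proof -
  interpret field_set F by fact
  have subQ: "subfield \<rat> (ambient :: 'a ring)" using Rats_field_set by (simp add: subfield_iff_field_set)
  obtain n where "ambient.dimension n \<rat> F" using dim by auto
  then obtain Us where Us: "ambient.Span \<rat> Us = F"
    using ambient.exists_base[OF subQ] by blast
  then have UsF: "set Us \<subseteq> F" using ambient.Span_base_incl[OF subQ, of Us] by simp
  have agree: "\<sigma> x = \<tau> x" if "x \<in> ambient.Span \<rat> Vs" "set Vs \<subseteq> F"
    "field_endo F \<sigma>" "field_endo F \<tau>" "\<forall>u\<in>set Vs. \<sigma> u = \<tau> u" for \<sigma> \<tau> x Vs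
  proof -
    interpret S: field_endo F \<sigma> by fact
    interpret T: field_endo F \<tau> by fact
    have "x \<in> F \<and> \<sigma> x = \<tau> x" using that(1,2,5)
    proof (induction Vs arbitrary: x)
      case (Cons u Vs)
      then obtain k v where "k \<in> \<rat>" "v \<in> ambient.Span \<rat> Vs" "x = k * u + v"
        by (auto simp: ambient_Span_Cons)
      moreover have "v \<in> F" "\<sigma> v = \<tau> v" "u \<in> F" "\<sigma> u = \<tau> u" "k \<in> F"
        using Cons \<open>v \<in> _\<close> \<open>k \<in> _\<close> Rats_subset by auto
      ultimately show ?case
        by (simp add: S.hom_add S.hom_mult T.hom_add T.hom_mult S.hom_Rats T.hom_Rats)
    qed auto
    then show ?thesis ..
  qed
  have "\<exists>P. P \<noteq> 0 \<and> ieval P u = 0" if "u \<in> F" for u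
    using algebraicE'[OF alg[OF that]] by (metis ieval_def)
  then obtain P where P: "\<And>u. u \<in> F \<Longrightarrow> P u \<noteq> 0 \<and> ieval (P u) u = 0" by metis
  have "finite {z::'a. ieval (P u) z = 0}" if "u \<in> F" for u
    using P[OF that] by (simp add: ieval_def poly_roots_finite map_poly_eq_0_iff)
  then have "finite (\<Pi>\<^sub>E u\<in>set Us. {z::'a. ieval (P u) z = 0})"
    using UsF by (intro finite_PiE) auto
  moreover have "(\<lambda>\<sigma>. restrict \<sigma> (set Us)) ` carrier (galois_group F \<rat>) \<subseteq> (\<Pi>\<^sub>E u\<in>set Us. {z. ieval (P u) z = 0})"
  proof clarify
    fix \<sigma> assume "\<sigma> \<in> carrier (galois_group F \<rat>)"
    then interpret S: field_endo F \<sigma> using F by (simp add: mem_galois_group_iff)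
    show "restrict \<sigma> (set Us) \<in> (\<Pi>\<^sub>E u\<in>set Us. {z. ieval (P u) z = 0})"
    proof (rule restrict_PiE_iff[THEN iffD2], intro ballI CollectI)
      fix u assume "u \<in> set Us"
      then have "u \<in> F" using UsF by blast
      then show "ieval (P u) (\<sigma> u) = 0" using P[of u] S.hom_ieval[of u "P u"] by simp
    qed
  qed
  moreover have "inj_on (\<lambda>\<sigma>. restrict \<sigma> (set Us)) (carrier (galois_group F \<rat>))"
  proof (rule inj_onI)
    fix \<sigma> \<tau> assume G: "\<sigma> \<in> carrier (galois_group F \<rat>)" "\<tau> \<in> carrier (galois_group F \<rat>)"
      and eq: "restrict \<sigma> (set Us) = restrict \<tau> (set Us)"
    have "\<forall>u\<in>set Us. \<sigma> u = \<tau> u" using fun_cong[OF eq] by (metis restrict_apply')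
    moreover have "field_endo F \<sigma>" "field_endo F \<tau>" using G F by (simp_all add: mem_galois_group_iff)
    ultimately show "\<sigma> = \<tau>"
      using Us UsF agree by (intro galois_group_eqI[OF F G]) blast
  qed
  ultimately show ?thesis using finite_imageD finite_subset by blast
qed

text \<open>By the tower law \<open>p\<close> is the product of the two partial degrees, so one of
  them is 1. Applied later to the fixed field of a stabiliser.\<close>

lemma no_intermediate_field:
  assumes F: "field_set (F :: 'a::field_char_0 set)" and dim: "ambient.dimension p \<rat> F" and p: "prime p"
    and E: "field_set E" "E \<subseteq> F"
  shows "E = \<rat> \<or> E = F"
proof -
  have subQ: "subfield \<rat> (ambient :: 'a ring)" using Rats_field_set by (simp add: subfield_iff_field_set)
  have subE: "subfield E ambient" using E by (simp add: subfield_iff_field_set)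
  interpret E: field_set E by fact
  interpret F: field_set F by fact
  obtain Us where Us: "ambient.Span \<rat> Us = F"
    using ambient.exists_base[OF subQ dim] by blast
  then have UsF: "set Us \<subseteq> F" using ambient.Span_base_incl[OF subQ, of Us] by simp
  have mono: "ambient.Span \<rat> Vs \<subseteq> ambient.Span E Vs" for Vs
  proof (induction Vs)
    case (Cons u Vs)
    then show ?case using E.Rats_subset by (fastforce simp: ambient_Span_Cons)
  qed auto
  have sub: "ambient.Span E Vs \<subseteq> F" if "set Vs \<subseteq> F" for Vs
    using that
  proof (induction Vs)
    case (Cons u Vs)
    then show ?case using E(2)
      by (force simp: ambient_Span_Cons)
  qed auto
  have "ambient.Span E Us = F" using Us mono[of Us] sub[OF UsF] by auto
  then have finE: "ambient.finite_dimension E F"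
    using ambient.Span_finite_dimension[OF subE, of Us] by simp
  have "subalgebra \<rat> E ambient"
    unfolding subalgebra_def subalgebra_axioms_def
    using E.Rats_subset subring.axioms(1)[OF subfieldE(1)[OF subE]] by auto
  then have finQ: "ambient.finite_dimension \<rat> E"
    using ambient.subalbegra_incl_imp_finite_dimension[OF subQ _ _ E(2)] dim
      ambient.finite_dimensionI by blast
  obtain n m where nm: "ambient.dimension n \<rat> E" "ambient.dimension m E F"
    using finE finQ by (auto simp: ambient.finite_dimension_def)
  have "ambient.dimension (n * m) \<rat> F" by (rule ambient.telescopic_base[OF subQ subE nm])
  then have "p = n * m" using dim ambient.dimension_is_inj[OF subQ] by blast
  then have "n = 1 \<or> m = 1" using p prime_product by simp
  have one: "C = B" if "ambient.dimension 1 B C" "field_set B" "field_set C" for B C :: "'a set"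
  proof -
    have subB: "subfield B ambient" using that by (simp add: subfield_iff_field_set)
    interpret B: field_set B by fact
    interpret C: field_set C by fact
    have "ambient.independent B [1]"
      by (intro ambient.li_Cons) auto
    then have "ambient.Span B [1] = C"
      using ambient.independent_length_eq_dimension[OF subB that(1), of "[1]"] by simp
    then show ?thesis by (auto simp: ambient_Span_Cons)
  qed
  show ?thesis using \<open>n = 1 \<or> m = 1\<close>
  proof
    assume "n = 1"
    then show ?thesis using one[OF nm(1)[unfolded \<open>n = 1\<close>]] Rats_field_set E(1) by blast
  next
    assume "m = 1"
    then show ?thesis using one[OF nm(2)[unfolded \<open>m = 1\<close>]] F E(1) by blast
  qed
qed

section \<open>Roots of unity\<close>

lemma primitive_root_power_eq_1_iff:
  assumes "primitive_root_of_unity n z"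
  shows "z ^ k = 1 \<longleftrightarrow> n dvd k"
proof -
  have n: "n > 0" "z ^ n = 1" and min: "\<And>k. 0 < k \<Longrightarrow> k < n \<Longrightarrow> z ^ k \<noteq> 1"
    using assms by (auto simp: primitive_root_of_unity_def)
  have "z ^ k = z ^ (n * (k div n) + k mod n)" by simp
  also have "\<dots> = z ^ (k mod n)" using n by (simp only: power_add power_mult power_one mult_1_left)
  finally have eq: "z ^ k = z ^ (k mod n)" .
  show ?thesis
  proof (cases "k mod n = 0")
    case False
    then have "z ^ (k mod n) \<noteq> 1" using n min by simp
    then show ?thesis using eq False by (simp add: dvd_eq_mod_eq_0)
  qed (use eq in \<open>auto simp: dvd_eq_mod_eq_0\<close>)
qed

lemma primitive_root_nonzero: "primitive_root_of_unity n z \<Longrightarrow> z \<noteq> 0"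
  by (auto simp: primitive_root_of_unity_def power_0_left)

lemma primitive_root_power_eq_iff:
  fixes z :: "'a::field"
  assumes "primitive_root_of_unity n z"
  shows "z ^ a = z ^ b \<longleftrightarrow> a mod n = b mod n"
proof -
  have *: "z ^ a = z ^ b \<longleftrightarrow> a mod n = b mod n" if "a \<le> b" for a b
  proof -
    have "z ^ b = z ^ a * z ^ (b - a)" using that by (simp flip: power_add)
    then have "z ^ a = z ^ b \<longleftrightarrow> z ^ (b - a) = 1"
      using primitive_root_nonzero[OF assms] by auto
    also have "\<dots> \<longleftrightarrow> n dvd b - a" by (rule primitive_root_power_eq_1_iff[OF assms])
    also have "\<dots> \<longleftrightarrow> b mod n = a mod n" using that by (simp add: mod_eq_dvd_iff_nat)
    finally show ?thesis by auto
  qed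
  show ?thesis using *[of a b] *[of b a] by (cases "a \<le> b") auto
qed

lemma primitive_root_power_mod:
  fixes z :: "'a::field"
  shows "primitive_root_of_unity n z \<Longrightarrow> z ^ (a mod n) = z ^ a"
  by (subst primitive_root_power_eq_iff) auto

lemma root_of_unity_is_power:
  fixes z :: "'a::field"
  assumes z: "primitive_root_of_unity n z" and "w ^ n = 1"
  shows "\<exists>k<n. w = z ^ k"
proof -
  have n: "n > 0" using z by (auto simp: primitive_root_of_unity_def)
  define P where "P = monom (1::'a) n - 1"
  have coeffP: "coeff P n = 1" using n by (simp add: P_def coeff_1)
  then have "P \<noteq> 0" by auto
  have "degree P \<le> n" unfolding P_def by (intro degree_diff_le) (auto simp: degree_monom_le)
  have roots: "{x. poly P x = 0} = {x. x ^ n = 1}" by (simp add: P_def poly_monom)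
  have "inj_on (\<lambda>k. z ^ k) {..<n}"
    using primitive_root_power_eq_iff[OF z] by (auto simp: inj_on_def)
  then have "card ((\<lambda>k. z ^ k) ` {..<n}) = n" by (simp add: card_image)
  moreover have sub: "(\<lambda>k. z ^ k) ` {..<n} \<subseteq> {x. poly P x = 0}"
    using primitive_root_power_eq_1_iff[OF z] by (auto simp: roots simp flip: power_mult)
  moreover have "card {x. poly P x = 0} \<le> n"
    using card_poly_roots_bound[OF \<open>P \<noteq> 0\<close>] \<open>degree P \<le> n\<close> by linarith
  ultimately have "(\<lambda>k. z ^ k) ` {..<n} = {x. poly P x = 0}"
    using poly_roots_finite[OF \<open>P \<noteq> 0\<close>] by (intro card_seteq) auto
  then show ?thesis using assms(2) roots by auto
qed

lemma primitive_root_of_prime_power: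
  fixes y :: "'a::field"
  assumes p: "prime p" and y: "primitive_root_of_unity p (y ^ p)"
  shows "primitive_root_of_unity (p\<^sup>2) y"
proof -
  have "y ^ k \<noteq> 1" if k: "0 < k" "k < p\<^sup>2" for k
  proof
    assume 1: "y ^ k = 1"
    then have "(y ^ p) ^ k = 1" by (simp flip: power_mult add: mult.commute[of p] power_mult)
    then have "p dvd k" using primitive_root_power_eq_1_iff[OF y] by blast
    then obtain l where l: "k = p * l" by blast
    then have "(y ^ p) ^ l = 1" using 1 by (simp add: power_mult)
    then have "p dvd l" using primitive_root_power_eq_1_iff[OF y] by blast
    then have "p\<^sup>2 dvd k" using l by (simp add: power2_eq_square)
    then show False using k nat_dvd_not_less by blast
  qed
  moreover have "y ^ p\<^sup>2 = 1"
    using y by (simp add: power2_eq_square power_mult primitive_root_of_unity_def)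
  ultimately show ?thesis using p by (simp add: primitive_root_of_unity_def prime_gt_0_nat)
qed

lemma primitive_root_pth_power:
  fixes \<xi> :: "'a::field"
  assumes p: "prime p" and xi: "primitive_root_of_unity (p\<^sup>2) \<xi>"
  shows "primitive_root_of_unity p (\<xi> ^ p)"
  using p primitive_root_power_eq_1_iff[OF xi]
  by (auto simp: primitive_root_of_unity_def prime_gt_0_nat power2_eq_square
      dest: nat_dvd_not_less simp flip: power_mult)

lemma sum_powers_root_of_unity:
  fixes z :: "'a::field"
  assumes "z ^ n = 1" "z \<noteq> 1"
  shows "(\<Sum>k<n. z ^ k) = 0"
  using assms by (simp add: geometric_sum)

text \<open>Subtracting \<open>d (p - 1)\<close> times the sum of all powers, which vanishes at each
  \<open>\<zeta> ^ a\<close>, leaves a polynomial of degree at most \<open>p - 2\<close> with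
  \<open>p - 1\<close> roots.\<close>

lemma vanishing_at_primitive_roots:
  fixes \<zeta> :: "'a::field" and d :: "nat \<Rightarrow> 'a"
  assumes p: "prime p" and z: "primitive_root_of_unity p \<zeta>"
    and vanish: "\<And>a. 0 < a \<Longrightarrow> a < p \<Longrightarrow> (\<Sum>k<p. d k * (\<zeta> ^ a) ^ k) = 0"
    and k: "k < p" "l < p"
  shows "d k = d l"
proof -
  have p1: "p > 1" using p prime_gt_1_nat by blast
  define Q where "Q = (\<Sum>k<p - 1. monom (d k - d (p - 1)) k)"
  have coeffQ: "coeff Q i = (if i < p - 1 then d i - d (p - 1) else 0)" for i
    by (simp add: Q_def coeff_sum)
  have "poly Q (\<zeta> ^ a) = 0" if a: "0 < a" "a < p" for a
  proof -
    have split: "{..<p} = insert (p - 1) {..<p - 1}" using p1 by auto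
    have "\<zeta> ^ a \<noteq> 1" using primitive_root_power_eq_1_iff[OF z] a nat_dvd_not_less by blast
    moreover have "(\<zeta> ^ a) ^ p = 1"
      using primitive_root_power_eq_1_iff[OF z] by (simp flip: power_mult)
    ultimately have 0: "(\<Sum>k<p. (\<zeta> ^ a) ^ k) = 0" by (intro sum_powers_root_of_unity)
    have "poly Q (\<zeta> ^ a) = (\<Sum>k<p - 1. (d k - d (p - 1)) * (\<zeta> ^ a) ^ k)"
      by (simp add: Q_def poly_sum poly_monom)
    also have "\<dots> = (\<Sum>k<p. (d k - d (p - 1)) * (\<zeta> ^ a) ^ k)" by (simp add: split)
    also have "\<dots> = (\<Sum>k<p. d k * (\<zeta> ^ a) ^ k) - d (p - 1) * (\<Sum>k<p. (\<zeta> ^ a) ^ k)"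
      by (simp add: left_diff_distrib sum_subtractf sum_distrib_left)
    finally show ?thesis using vanish[OF a] 0 by simp
  qed
  have "Q = 0"
  proof (rule ccontr)
    assume "Q \<noteq> 0"
    have "degree Q \<le> p - 2"
    proof (rule degree_le, intro allI impI)
      fix i assume "p - 2 < i"
      then have "\<not> i < p - 1" using p1 by linarith
      then show "coeff Q i = 0" by (simp add: coeffQ)
    qed
    moreover have "(\<lambda>a. \<zeta> ^ a) ` {0<..<p} \<subseteq> {x. poly Q x = 0}"
      using \<open>\<And>a. _ \<Longrightarrow> _ \<Longrightarrow> poly Q (\<zeta> ^ a) = 0\<close> by auto
    moreover have "inj_on (\<lambda>a. \<zeta> ^ a) {0<..<p}"
      using primitive_root_power_eq_iff[OF z] by (auto simp: inj_on_def)
    then have "card ((\<lambda>a. \<zeta> ^ a) ` {0<..<p}) = p - 1" by (simp add: card_image)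
    ultimately have "p - 1 \<le> p - 2"
      using card_poly_roots_bound[OF \<open>Q \<noteq> 0\<close>] card_mono[OF poly_roots_finite[OF \<open>Q \<noteq> 0\<close>]]
      by (metis order_trans)
    then show False using p1 by simp
  qed
  then have "d i = d (p - 1)" if "i < p - 1" for i
    using coeffQ[of i] that by simp
  moreover have "i = p - 1 \<or> i < p - 1" if "i < p" for i using that by linarith
  ultimately have "d i = d (p - 1)" if "i < p" for i using that by metis
  then show ?thesis using k by metis
qed

lemma cong_1_if_prime_factors_cong_1:
  fixes N m :: nat
  assumes "N > 0" "\<And>q. prime q \<Longrightarrow> q dvd N \<Longrightarrow> [q = 1] (mod m)"
  shows "[N = 1] (mod m)"
  using assms
proof (induction N rule: less_induct)
  case (less N)
  show ?case
  proof (cases "N = 1")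
    case False
    then obtain q where q: "prime q" "q dvd N" using prime_factor_nat by blast
    then obtain N' where N': "N = q * N'" by blast
    have "N' < N" using N' less.prems prime_gt_1_nat[OF q(1)] by auto
    then have "[N' = 1] (mod m)" using less N' by auto
    then show ?thesis using cong_mult[OF less.prems(2)[OF q]] N' by force
  qed simp
qed

text \<open>An element \<open>s\<close> whose \<open>p\<close>-th power is a primitive \<open>p\<close>-th root of unity modulo \<open>q\<close>
  has order \<open>p\<^sup>2\<close>.\<close>

lemma cong_1_mod_prime_square:
  fixes p q n s :: nat
  assumes p: "prime p" and q: "prime q" and s: "[s ^ p = n] (mod q)"
    and n: "[n ^ p = 1] (mod q)" "\<not> [n = 1] (mod q)"
  shows "[q = 1] (mod p\<^sup>2)"
proof -
  have "[s ^ p\<^sup>2 = 1] (mod q)"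
    using cong_trans[OF cong_pow[OF s, of p] n(1)] by (simp add: power2_eq_square power_mult)
  then have "ord q s dvd p\<^sup>2" using ord_divides by blast
  then obtain i where i: "i \<le> 2" "ord q s = p ^ i" using divides_primepow_nat[OF p] by blast
  have "\<not> [s ^ p = 1] (mod q)" using s n(2) cong_sym cong_trans by blast
  then have "\<not> ord q s dvd p" using ord_divides by blast
  then have "\<not> i \<le> 1" using i(2) le_imp_power_dvd[of i 1 p] by auto
  then have ord: "ord q s = p\<^sup>2" using i by (simp add: le_Suc_eq numeral_2_eq_2)
  have "\<not> q dvd s"
  proof
    assume "q dvd s"
    then have "[s = 0] (mod q)" by (simp add: cong_0_iff)
    then have "[s ^ p\<^sup>2 = 0 ^ p\<^sup>2] (mod q)" by (rule cong_pow)
    moreover have "(0::nat) ^ p\<^sup>2 = 0" using p by (simp add: prime_gt_0_nat power_0_left)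
    ultimately have "[1 = 0] (mod q)" using \<open>[s ^ p\<^sup>2 = 1] (mod q)\<close> cong_sym cong_trans by metis
    then show False using prime_gt_1_nat[OF q] by (simp add: cong_def)
  qed
  then have "[s ^ (q - 1) = 1] (mod q)" by (rule fermat_theorem[OF q])
  then have "p\<^sup>2 dvd q - 1" using ord ord_divides by metis
  then have "[q - 1 + 1 = 0 + 1] (mod p\<^sup>2)" by (intro cong_add) (simp_all add: cong_0_iff)
  then show ?thesis using prime_gt_0_nat[OF q] by simp
qed

section \<open>Adjoining a root of unity to a cyclic extension\<close>

definition combination :: "nat \<Rightarrow> 'a::field \<Rightarrow> (nat \<Rightarrow> 'a) \<Rightarrow> 'a" where
  "combination p z f = (\<Sum>k<p. f k * z ^ k)"

text \<open>The product in the group algebra of the cyclic group of order \<open>p\<close>.\<close>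

definition cyclic_convolution :: "nat \<Rightarrow> (nat \<Rightarrow> 'a::field) \<Rightarrow> (nat \<Rightarrow> 'a) \<Rightarrow> nat \<Rightarrow> 'a" where
  "cyclic_convolution p f g m = (\<Sum>k<p. \<Sum>l<p. if (k + l) mod p = m then f k * g l else 0)"

lemma combination_mult:
  assumes "z ^ p = 1" "p > 0"
  shows "combination p z f * combination p z g = combination p z (cyclic_convolution p f g)"
proof -
  have red: "z ^ (i mod p) = z ^ i" for i
  proof -
    have "z ^ i = z ^ (p * (i div p) + i mod p)" by simp
    also have "\<dots> = z ^ (i mod p)" using assms by (simp only: power_add power_mult power_one mult_1_left)
    finally show ?thesis ..
  qed
  have "combination p z (cyclic_convolution p f g)
      = (\<Sum>m<p. \<Sum>k<p. \<Sum>l<p. if (k + l) mod p = m then f k * g l * z ^ m else 0)"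
    unfolding combination_def cyclic_convolution_def sum_distrib_right
    by (intro sum.cong refl) auto
  also have "\<dots> = (\<Sum>k<p. \<Sum>m<p. \<Sum>l<p. if (k + l) mod p = m then f k * g l * z ^ m else 0)"
    by (rule sum.swap)
  also have "\<dots> = (\<Sum>k<p. \<Sum>l<p. \<Sum>m<p. if (k + l) mod p = m then f k * g l * z ^ m else 0)"
    by (intro sum.cong refl sum.swap)
  also have "\<dots> = (\<Sum>k<p. \<Sum>l<p. f k * g l * z ^ (k + l))"
    using assms by (simp add: red)
  also have "\<dots> = combination p z f * combination p z g"
    by (simp add: combination_def sum_product power_add mult_ac)
  finally show ?thesis ..
qed

lemma combination_add: "combination p z f + combination p z g = combination p z (\<lambda>k. f k + g k)"
  by (simp add: combination_def sum.distrib distrib_right)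

lemma combination_diff: "combination p z f - combination p z g = combination p z (\<lambda>k. f k - g k)"
  by (simp add: combination_def sum_subtractf left_diff_distrib)

lemma combination_const: "p > 0 \<Longrightarrow> combination p z (\<lambda>k. if k = 0 then c else 0) = c"
  by (simp add: combination_def if_distrib[of "\<lambda>x. x * _"] sum.delta cong: if_cong)

lemma combination_sum: "(\<Sum>i\<in>I. combination p z (f i)) = combination p z (\<lambda>k. \<Sum>i\<in>I. f i k)"
  unfolding combination_def by (subst sum.swap) (simp add: sum_distrib_right)

lemma (in field_set) combination_closed: "z \<in> E \<Longrightarrow> (\<And>k. f k \<in> E) \<Longrightarrow> combination p z f \<in> E"
  unfolding combination_def by (intro sum_closed) simp

lemma (in field_set) convolution_closed:
  "(\<And>k. f k \<in> E) \<Longrightarrow> (\<And>k. g k \<in> E) \<Longrightarrow> cyclic_convolution p f g m \<in> E"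
  unfolding cyclic_convolution_def by (intro sum_closed) simp

lemma (in field_endo) hom_convolution:
  assumes "\<And>k. f k \<in> E" "\<And>k. g k \<in> E"
  shows "\<sigma> (cyclic_convolution p f g m) = cyclic_convolution p (\<lambda>k. \<sigma> (f k)) (\<lambda>k. \<sigma> (g k)) m"
  unfolding cyclic_convolution_def using assms
  by (simp add: hom_sum sum_closed if_distrib[of \<sigma>] hom_mult cong: if_cong)

lemma (in field_endo) hom_combination:
  "z \<in> E \<Longrightarrow> (\<And>k. f k \<in> E) \<Longrightarrow> \<sigma> (combination p z f) = combination p (\<sigma> z) (\<lambda>k. \<sigma> (f k))"
  unfolding combination_def by (simp add: hom_sum hom_mult hom_power)

text \<open>Closure under products is the convolution. For inverses, a polynomial relation with
  constant term \<open>c\<close> nonzero, divided by \<open>x\<close>, expresses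
  \<open>inverse x\<close> as an integer polynomial in \<open>x\<close> times
  \<open>- 1 / c\<close>.\<close>

lemma field_set_adjoin_root_of_unity:
  fixes B :: "'a::field_char_0 set"
  assumes B: "field_set B" and z: "z ^ p = 1" "p > 0" and alg: "\<And>x::'a. algebraic x"
  shows "field_set {combination p z f | f. \<forall>k. f k \<in> B}" (is "field_set ?S")
proof -
  interpret field_set B by fact
  have SI: "x \<in> ?S" if "x = combination p z f" "\<And>k. f k \<in> B" for x f using that by blast
  have base: "b \<in> ?S" if "b \<in> B" for b
    using that z by (intro SI[of _ "\<lambda>k. if k = 0 then b else 0"]) (auto simp: combination_const)
  have add: "x + y \<in> ?S" if "x \<in> ?S" "y \<in> ?S" for x y
    using that by (auto simp: combination_add intro!: SI)
  have mult: "x * y \<in> ?S" if "x \<in> ?S" "y \<in> ?S" for x y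
    using that z by (auto simp: combination_mult intro!: SI convolution_closed)
  have ieval: "ieval g x \<in> ?S" if "x \<in> ?S" for g x
  proof (induction g)
    case (pCons a g)
    have "of_int a \<in> ?S" by (rule base) simp
    then show ?case using add mult that pCons by simp
  qed (use base[of 0] in simp)
  have minus: "- x \<in> ?S" if "x \<in> ?S" for x
    using mult[OF base[of "-1"] that] by simp
  have inverse: "inverse x \<in> ?S" if x: "x \<in> ?S" for x
  proof (cases "x = 0")
    case False
    then obtain P where P: "coeff P 0 \<noteq> 0" "ieval P x = 0"
      using algebraicE'_nonzero[OF alg] by (metis ieval_def)
    obtain c P' where P': "P = pCons c P'" by (cases P)
    have "x * ieval P' x = - of_int c" using P(2) by (simp add: P' eq_neg_iff_add_eq_0 add.commute)
    then have "x * (ieval P' x * (- 1 / of_int c)) = 1"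
      using P(1) P' by (simp flip: mult.assoc)
    then have "inverse x = ieval P' x * (- 1 / of_int c)" by (rule inverse_unique)
    also have "\<dots> \<in> ?S" by (intro mult ieval x base) simp
    finally show ?thesis .
  qed (use base[of 0] in simp)
  show ?thesis
    using base[of 1] minus add mult inverse by unfold_locales auto
qed

section \<open>The compositum of F and K: coefficients, disjointness, extension of
  automorphisms\<close>

locale cyclic_kummer_setup =
  fixes p e :: nat and \<zeta> :: "'a::field_char_0" and F K L :: "'a set" and \<tau> :: "'a \<Rightarrow> 'a"
  assumes alg: "\<And>x::'a. algebraic x"
    and p: "prime p" "odd p"
    and F: "cyclic_extension p F \<rat>"
    and zeta: "primitive_root_of_unity p \<zeta>"
    and K: "K = generate_field ambient {\<zeta>}"
    and L: "L = generate_field ambient (F \<union> K)"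
    and e: "residue_primroot p e"
    and tau: "\<tau> \<in> carrier (galois_group L F)" "\<tau> \<zeta> = \<zeta> ^ e"
begin

abbreviation comb :: "(nat \<Rightarrow> 'a) \<Rightarrow> 'a" where "comb \<equiv> combination p \<zeta>"

abbreviation "Gal \<equiv> carrier (galois_group F \<rat>)"

lemma p_gt_1: "p > 1" and p_gt_0: "p > 0"
  using p prime_gt_1_nat by (auto simp: prime_gt_0_nat)

lemma zeta_p: "\<zeta> ^ p = 1"
  using zeta by (simp add: primitive_root_of_unity_def)

lemma field_F: "field_set F" and dim_F: "ambient.dimension p \<rat> F"
  and fixed_F: "x \<in> F \<Longrightarrow> (\<And>\<sigma>. \<sigma> \<in> Gal \<Longrightarrow> \<sigma> x = x) \<Longrightarrow> x \<in> \<rat>"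
  using F by (auto simp: cyclic_extension_def galois_extension_def subfield_iff_field_set)

sublocale F: field_set F by (rule field_F)

sublocale K: field_set K unfolding K by (rule field_set_generate)

sublocale L: field_set L unfolding L by (rule field_set_generate)

lemma F_subset: "F \<subseteq> L" and K_subset: "K \<subseteq> L"
  using generate_field_contains[of "F \<union> K"] by (auto simp: L)

lemma zeta_K: "\<zeta> \<in> K"
  using generate_field_contains[of "{\<zeta>}"] by (auto simp: K)

lemma zeta_L: "\<zeta> \<in> L"
  using zeta_K K_subset by blast

sublocale tau: field_endo L \<tau>
  using tau(1) L.field_set_axioms by (simp add: mem_galois_group_iff)

lemma tau_F: "x \<in> F \<Longrightarrow> \<tau> x = x"
  using tau(1) L.field_set_axioms by (simp add: mem_galois_group_iff)

lemma Gal_endo: "g \<in> Gal \<Longrightarrow> field_endo F g"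
  by (simp add: mem_galois_group_iff field_F)

lemma Gal_closed: "g \<in> Gal \<Longrightarrow> x \<in> F \<Longrightarrow> g x \<in> F"
  using Gal_endo field_endo.maps by blast

lemma K_eq: "K = {comb f | f. \<forall>k. f k \<in> \<rat>}"
proof
  have "\<zeta> = comb (\<lambda>k. if k = 1 then 1 else 0)"
    using p_gt_1 by (simp add: combination_def if_distrib[of "\<lambda>x. x * _"] sum.delta cong: if_cong)
  then have "\<zeta> \<in> {comb f | f. \<forall>k. f k \<in> \<rat>}" by force
  then show "K \<subseteq> {comb f | f. \<forall>k. f k \<in> \<rat>}"
    unfolding K using Rats_field_set zeta_p p_gt_0 alg
    by (intro generate_field_minimal field_set_adjoin_root_of_unity) auto
  show "{comb f | f. \<forall>k. f k \<in> \<rat>} \<subseteq> K"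
    using K.Rats_subset zeta_K by (auto intro!: K.combination_closed)
qed

lemma L_eq: "L = {comb f | f. \<forall>k. f k \<in> F}" (is "L = ?S")
proof
  have "F \<subseteq> ?S"
  proof
    fix x assume "x \<in> F"
    then show "x \<in> ?S"
      using p_gt_0 by (intro CollectI exI[of _ "\<lambda>k. if k = 0 then x else 0"]) (auto simp: combination_const)
  qed
  moreover have "K \<subseteq> ?S" using F.Rats_subset unfolding K_eq by blast
  ultimately show "L \<subseteq> ?S"
    unfolding L using field_F zeta_p p_gt_0 alg
    by (intro generate_field_minimal field_set_adjoin_root_of_unity) auto
  show "?S \<subseteq> L"
    using F_subset zeta_L by (auto intro!: L.combination_closed)
qed

lemma exponent_bij: "bij_betw (\<lambda>i. e ^ i mod p) {..<p - 1} {0<..<p}"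
  using residue_primroot_is_generator[OF p_gt_1 e] p by (simp add: totient_prime totatives_prime)

lemma exponent_exists:
  assumes "0 < a" "a < p" shows "\<exists>j<p - 1. \<zeta> ^ (e ^ j) = \<zeta> ^ a"
proof -
  have "a \<in> (\<lambda>i. e ^ i mod p) ` {..<p - 1}"
    using exponent_bij assms unfolding bij_betw_def by simp
  then obtain j where "j < p - 1" "e ^ j mod p = a" by auto
  then show ?thesis using primitive_root_power_mod[OF zeta, of "e ^ j"] by auto
qed

lemma coprime_e: "coprime e p"
  using e by (simp add: residue_primroot_def coprime_commute)

lemma tau_power_closed: "x \<in> L \<Longrightarrow> (\<tau> ^^ j) x \<in> L"
  by (induction j) auto

lemma tau_power_endo: "field_endo L (\<tau> ^^ j)"
proof (induction j)
  case 0
  show ?case by unfold_locales auto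
next
  case (Suc j)
  then interpret J: field_endo L "\<tau> ^^ j" .
  show ?case by unfold_locales (auto simp: J.hom_add J.hom_mult tau.hom_add tau.hom_mult)
qed

lemma tau_power_F: "x \<in> F \<Longrightarrow> (\<tau> ^^ j) x = x"
  by (induction j) (auto simp: tau_F)

lemma tau_power_zeta: "(\<tau> ^^ j) \<zeta> = \<zeta> ^ (e ^ j)"
  using zeta_L by (induction j) (auto simp: tau.hom_power tau(2) power_mult[symmetric] mult.commute)

lemma tau_power_comb:
  assumes "\<And>k. f k \<in> F"
  shows "(\<tau> ^^ j) (comb f) = combination p (\<zeta> ^ (e ^ j)) f"
proof -
  interpret J: field_endo L "\<tau> ^^ j" by (rule tau_power_endo)
  have "f k \<in> L" for k using assms F_subset by blast
  then show ?thesis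
    using zeta_L assms by (simp add: J.hom_combination tau_power_zeta tau_power_F)
qed

text \<open>\<open>F\<close> and \<open>K\<close> are linearly disjoint because the powers of \<open>\<tau>\<close> already realise all the conjugates
  of \<open>\<zeta>\<close> over \<open>F\<close>.\<close>

lemma comb_eq_0_imp_constant:
  assumes d: "\<And>k. d k \<in> F" and 0: "comb d = 0" and "k < p" "l < p"
  shows "d k = d l"
proof (rule vanishing_at_primitive_roots[OF p(1) zeta _ \<open>k < p\<close> \<open>l < p\<close>])
  fix a assume "0 < a" "a < p"
  then obtain j where j: "\<zeta> ^ (e ^ j) = \<zeta> ^ a" using exponent_exists by blast
  interpret J: field_endo L "\<tau> ^^ j" by (rule tau_power_endo)
  have "combination p (\<zeta> ^ a) d = 0"
    using tau_power_comb[where f = d and j = j] d 0 j by simp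
  then show "(\<Sum>k<p. d k * (\<zeta> ^ a) ^ k) = 0" by (simp add: combination_def)
qed

lemma sum_zeta_powers: "(\<Sum>k<p. \<zeta> ^ k) = 0"
  using primitive_root_power_eq_1_iff[OF zeta, of 1] p_gt_1 zeta_p
  by (intro sum_powers_root_of_unity) auto

text \<open>The sum of all powers of \<open>\<zeta>\<close> is 0, so \<open>f 0\<close> may be
  subtracted from every coefficient. This removes the only ambiguity in the coefficients below
  \<open>p\<close>.\<close>

lemma comb_normal_form:
  assumes "x \<in> L"
  obtains f where "\<And>k. f k \<in> F" "x = comb f" "f 0 = 0"
proof -
  obtain f where f: "\<And>k. f k \<in> F" "x = comb f" using assms unfolding L_eq by blast
  have "comb (\<lambda>k. f k - f 0) = comb f - f 0 * (\<Sum>k<p. \<zeta> ^ k)"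
    by (simp add: combination_def left_diff_distrib sum_subtractf sum_distrib_left)
  then show ?thesis using f sum_zeta_powers by (intro that[of "\<lambda>k. f k - f 0"]) auto
qed

text \<open>If \<open>x\<close> is fixed, the expression of \<open>x\<close> stays valid when
  \<open>\<zeta>\<close> is replaced by any other primitive \<open>p\<close>-th root. Moving
  \<open>x\<close> into the coefficient at 0 gives coefficients that vanish at all these roots,
  hence are equal.\<close>

lemma tau_fixed:
  assumes "x \<in> L" "\<tau> x = x"
  shows "x \<in> F"
proof -
  obtain f where f: "\<And>k. f k \<in> F" "x = comb f" using assms(1) unfolding L_eq by blast
  have fixed: "(\<tau> ^^ j) x = x" for j using assms(2) by (induction j) auto
  \<comment> \<open>These coefficients lie in \<open>L\<close>, not yet in \<open>F\<close>.
    Comparing those at 0 and 1 gives \<open>x = f 0 - f 1\<close>.\<close>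
  define d where "d = (\<lambda>k. f k - (if k = 0 then x else 0))"
  have "d 0 = d 1"
  proof (rule vanishing_at_primitive_roots[OF p(1) zeta])
    fix a assume "0 < a" "a < p"
    then obtain j where j: "\<zeta> ^ (e ^ j) = \<zeta> ^ a" using exponent_exists by blast
    have "combination p (\<zeta> ^ a) d = combination p (\<zeta> ^ a) f - x"
      unfolding d_def combination_diff[symmetric] using p_gt_0 by (simp add: combination_const)
    also have "combination p (\<zeta> ^ a) f = x" using tau_power_comb[where f = f and j = j] fixed[of j] f j by simp
    finally show "(\<Sum>k<p. d k * (\<zeta> ^ a) ^ k) = 0" by (simp add: combination_def)
  qed (use p_gt_1 in auto)
  then have "x = f 0 - f 1" by (simp add: d_def algebra_simps)
  then show ?thesis using f(1) by simp
qed

text \<open>The automorphism of \<open>L\<close> that acts as \<open>g\<close> on coefficients in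
  \<open>F\<close> and fixes \<open>\<zeta>\<close>. An arbitrary choice of coefficients is made
  here; \<open>extend_comb\<close> shows that it does not matter.\<close>

definition extend :: "('a \<Rightarrow> 'a) \<Rightarrow> 'a \<Rightarrow> 'a" where
  "extend g = (\<lambda>x\<in>L. comb (\<lambda>k. g ((SOME f. (\<forall>k. f k \<in> F) \<and> x = comb f) k)))"

text \<open>Two families of coefficients of one element differ by a constant, and \<open>g\<close>
  sends it to a constant, whose contribution vanishes because the powers of \<open>\<zeta>\<close>
  sum to 0.\<close>

lemma extend_comb:
  assumes g: "g \<in> Gal" and f: "\<And>k. f k \<in> F"
  shows "extend g (comb f) = comb (\<lambda>k. g (f k))"
proof -
  interpret g: field_endo F g using Gal_endo g .
  define f' where "f' = (SOME f'. (\<forall>k. f' k \<in> F) \<and> comb f = comb f')"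
  have "\<exists>f'. (\<forall>k. f' k \<in> F) \<and> comb f = comb f'" using f by blast
  from someI_ex[OF this] have f': "\<And>k. f' k \<in> F" "comb f = comb f'" by (auto simp: f'_def)
  have "comb f \<in> L" using f unfolding L_eq by blast
  then have "extend g (comb f) = comb (\<lambda>k. g (f' k))" by (simp add: extend_def f'_def)
  also have "\<dots> = comb (\<lambda>k. g (f k)) + comb (\<lambda>k. g (f' k - f k))"
    using f f' by (simp add: combination_add g.hom_diff)
  also have "comb (\<lambda>k. g (f' k - f k)) = g (f' 0 - f 0) * (\<Sum>k<p. \<zeta> ^ k)"
  proof -
    have 0: "comb (\<lambda>k. f' k - f k) = 0" unfolding combination_diff[symmetric] f'(2) by simp
    have const: "f' k - f k = f' 0 - f 0" if "k < p" for k
      by (rule comb_eq_0_imp_constant[OF _ 0 that p_gt_0]) (simp add: f f'(1))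
    show ?thesis
      unfolding combination_def sum_distrib_left
    proof (rule sum.cong)
      fix k assume "k \<in> {..<p}"
      then have "f' k - f k = f' 0 - f 0" by (intro const) simp
      then show "g (f' k - f k) * \<zeta> ^ k = g (f' 0 - f 0) * \<zeta> ^ k" by (rule arg_cong)
    qed simp
  qed
  finally show ?thesis by (simp add: sum_zeta_powers)
qed

lemma extend_endo:
  assumes g: "g \<in> Gal"
  shows "field_endo L (extend g)"
proof -
  interpret g: field_endo F g using Gal_endo g .
  have maps: "extend g x \<in> L" if x: "x \<in> L" for x
  proof -
    obtain f where f: "\<And>k. f k \<in> F" "x = comb f" using x unfolding L_eq by blast
    then have "extend g x = comb (\<lambda>k. g (f k))" using g by (simp add: extend_comb)
    then show ?thesis using f g Gal_closed unfolding L_eq by blast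
  qed
  have hom: "extend g (x + y) = extend g x + extend g y \<and> extend g (x * y) = extend g x * extend g y"
    if xy: "x \<in> L" "y \<in> L" for x y
  proof -
    obtain f where f: "\<And>k. f k \<in> F" "x = comb f" using xy(1) unfolding L_eq by blast
    obtain f' where f': "\<And>k. f' k \<in> F" "y = comb f'" using xy(2) unfolding L_eq by blast
    show ?thesis using f f' g zeta_p p_gt_0
      by (simp add: combination_add combination_mult extend_comb g.hom_add F.convolution_closed g.hom_convolution)
  qed
  have "extend g 1 = extend g (comb (\<lambda>k. if k = 0 then 1 else 0))"
    using p_gt_0 by (simp add: combination_const)
  also have "\<dots> = comb (\<lambda>k. if k = 0 then 1 else 0)"
    using g by (subst extend_comb) (auto simp: if_distrib[of g] cong: if_cong)
  finally have "extend g 1 = 1" using p_gt_0 by (simp add: combination_const)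
  then show ?thesis using maps hom by unfold_locales auto
qed

lemma extend_F:
  assumes "g \<in> Gal" "x \<in> F" shows "extend g x = g x"
proof -
  interpret g: field_endo F g using Gal_endo assms(1) .
  have "extend g (comb (\<lambda>k. if k = 0 then x else 0)) = comb (\<lambda>k. g (if k = 0 then x else 0))"
    using assms by (intro extend_comb) auto
  also have "(\<lambda>k. g (if k = 0 then x else 0)) = (\<lambda>k::nat. if k = 0 then g x else 0)" by auto
  finally show ?thesis using p_gt_0 by (simp add: combination_const)
qed

lemma extend_K:
  assumes "g \<in> Gal" "x \<in> K" shows "extend g x = x"
proof -
  interpret g: field_endo F g using Gal_endo assms(1) .
  obtain f where f: "\<And>k. f k \<in> \<rat>" "x = comb f" using assms(2) unfolding K_eq by blast
  then show ?thesis using assms(1) F.Rats_subset by (subst f(2), subst extend_comb) (auto simp: g.hom_Rats)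
qed

lemma extend_in_galois_group:
  assumes g: "g \<in> Gal"
  shows "extend g \<in> carrier (galois_group L K)"
proof -
  interpret E: field_endo L "extend g" by (rule extend_endo) fact
  obtain h where h: "h \<in> Gal" "\<And>x. x \<in> F \<Longrightarrow> g (h x) = x"
    using galois_group_inverse[OF field_F F.Rats_subset g] by blast
  have "inj_on (extend g) L" by (auto simp: inj_on_def E.hom_inj)
  moreover have "L \<subseteq> extend g ` L"
  proof
    fix x assume "x \<in> L"
    then obtain f where f: "\<And>k. f k \<in> F" "x = comb f" unfolding L_eq by blast
    have "extend g (comb (\<lambda>k. h (f k))) = x"
      using g h f Gal_closed by (simp add: extend_comb)
    moreover have "comb (\<lambda>k. h (f k)) \<in> L" unfolding L_eq using f h Gal_closed by blast
    ultimately show "x \<in> extend g ` L" by blast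
  qed
  ultimately have "bij_betw (extend g) L L" unfolding bij_betw_def by auto
  then show ?thesis
    using extend_endo[OF g] extend_K[OF g] L.field_set_axioms
    by (auto simp: mem_galois_group_iff extend_def)
qed

end

section \<open>Elements inducing both extensions\<close>

lemma sum_eq_1_nonneg_int:
  fixes w :: "'b \<Rightarrow> int"
  assumes "finite I" "\<And>i. i \<in> I \<Longrightarrow> w i \<ge> 0" "(\<Sum>i\<in>I. w i) = 1"
  shows "\<exists>i\<in>I. w i = 1 \<and> (\<forall>j\<in>I - {i}. w j = 0)"
proof -
  have "\<exists>i\<in>I. w i \<noteq> 0" using assms(3) by (metis sum.neutral zero_neq_one)
  then obtain i where i: "i \<in> I" "w i > 0" using assms(2) by force
  have split: "w i + (\<Sum>j\<in>I - {i}. w j) = 1" using assms i by (simp flip: sum.remove)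
  moreover have "(\<Sum>j\<in>I - {i}. w j) \<ge> 0" using assms(2) by (intro sum_nonneg) auto
  ultimately have "w i = 1" "(\<Sum>j\<in>I - {i}. w j) = 0" using i by auto
  moreover from this(2) have "\<forall>j\<in>I - {i}. w j = 0"
    using assms by (subst (asm) sum_nonneg_eq_0_iff) auto
  ultimately show ?thesis using i by blast
qed

context field_set
begin

lemma valuation_one:
  fixes v :: "'a \<Rightarrow> int"
  assumes "\<forall>x\<in>E - {0}. \<forall>y\<in>E - {0}. v (x * y) = v x + v y"
  shows "v 1 = 0"
  using assms by (metis DiffI add_cancel_right_right empty_iff insert_iff mult_1 one_closed one_neq_zero)

lemma valuation_prod:
  fixes v :: "'a \<Rightarrow> int"
  assumes v: "\<forall>x\<in>E - {0}. \<forall>y\<in>E - {0}. v (x * y) = v x + v y"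
    and "finite I" "\<And>i. i \<in> I \<Longrightarrow> f i \<in> E - {0}"
  shows "v (\<Prod>i\<in>I. f i) = (\<Sum>i\<in>I. v (f i))"
  using assms(2,3)
proof (induction I rule: finite_induct)
  case (insert i I)
  have "(\<Prod>i\<in>I. f i) \<in> E - {0}"
    using insert by (auto intro!: prod_closed simp: prod_zero_iff)
  then show ?case using insert v by simp
qed (simp add: valuation_one[OF v])

lemma valuation_power:
  fixes v :: "'a \<Rightarrow> int"
  assumes v: "\<forall>x\<in>E - {0}. \<forall>y\<in>E - {0}. v (x * y) = v x + v y"
    and y: "y \<in> E - {0}"
  shows "v (y ^ n) = int n * v y"
  using valuation_prod[OF v, of "{..<n}" "\<lambda>_. y"] y by simp

end

section \<open>The Galois group of L over the rationals and its cosets modulo the group over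
  K\<close>

context cyclic_kummer_setup
begin

abbreviation "GalL \<equiv> carrier (galois_group L \<rat>)"
abbreviation "GalK \<equiv> carrier (galois_group L K)"

lemma GalK_subset: "GalK \<subseteq> GalL"
  using K.Rats_subset by (fastforce simp: mem_galois_group_iff[OF L.field_set_axioms])

lemma tau_GalL: "\<tau> \<in> GalL"
  using tau(1) F.Rats_subset by (fastforce simp: mem_galois_group_iff[OF L.field_set_axioms])

lemma GalL_endo: "\<sigma> \<in> GalL \<Longrightarrow> field_endo L \<sigma>"
  by (simp add: mem_galois_group_iff[OF L.field_set_axioms])

lemma GalK_zeta: "\<sigma> \<in> GalK \<Longrightarrow> \<sigma> \<zeta> = \<zeta>"
  using zeta_K by (simp add: mem_galois_group_iff[OF L.field_set_axioms])

text \<open>Invariance under \<open>\<tau>\<close> puts \<open>x\<close> into \<open>F\<close>, and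
  invariance under the extended automorphisms of \<open>F\<close> then makes it rational.\<close>

lemma fixed_L:
  assumes "x \<in> L" "\<And>\<sigma>. \<sigma> \<in> GalL \<Longrightarrow> \<sigma> x = x"
  shows "x \<in> \<rat>"
proof (rule fixed_F)
  show "x \<in> F" using assms tau_GalL by (intro tau_fixed) auto
  fix g assume "g \<in> Gal"
  then show "g x = x"
    using extend_F[of g x] \<open>x \<in> F\<close> assms(2)[of "extend g"] extend_in_galois_group GalK_subset by auto
qed

lemma finite_Gal: "finite Gal"
  using alg field_F dim_F by (intro finite_galois_group ambient.finite_dimensionI) auto

lemma galois_over_Rats_galois_group:
  assumes M: "field_set M" and fin: "finite (carrier (galois_group M \<rat>))"
    and fixed: "\<And>x. x \<in> M \<Longrightarrow> (\<And>\<sigma>. \<sigma> \<in> carrier (galois_group M \<rat>) \<Longrightarrow> \<sigma> x = x) \<Longrightarrow> x \<in> \<rat>"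
  shows "galois_over_Rats M (carrier (galois_group M \<rat>))"
proof -
  interpret M: field_set M by (rule M)
  show ?thesis
  proof (intro galois_over_Rats.intro galois_over_Rats_axioms.intro M fin)
    fix \<sigma> \<tau> assume G: "\<sigma> \<in> carrier (galois_group M \<rat>)" "\<tau> \<in> carrier (galois_group M \<rat>)"
    show "\<exists>\<rho>\<in>carrier (galois_group M \<rat>). \<forall>x\<in>M. \<rho> x = \<sigma> (\<tau> x)"
      using galois_group_compose[OF M M.Rats_subset G]
      by (intro bexI[of _ "compose M \<sigma> \<tau>"]) (simp_all add: compose_def)
    show "\<sigma> = \<tau>" if "\<And>x. x \<in> M \<Longrightarrow> \<sigma> x = \<tau> x" using galois_group_eqI[OF M G that] .
  next
    show "\<exists>\<iota>\<in>carrier (galois_group M \<rat>). \<forall>x\<in>M. \<iota> x = x"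
      using galois_group_id[OF M M.Rats_subset] by (intro bexI) auto
  next
    show "field_endo M \<sigma>" if "\<sigma> \<in> carrier (galois_group M \<rat>)" for \<sigma>
      using that M by (simp add: mem_galois_group_iff)
    show "x \<in> \<rat>" if "x \<in> M" "\<And>\<sigma>. \<sigma> \<in> carrier (galois_group M \<rat>) \<Longrightarrow> \<sigma> x = x" for x
      using fixed that .
  qed
qed

sublocale galF: galois_over_Rats F Gal
  using field_F finite_Gal fixed_F by (rule galois_over_Rats_galois_group)

text \<open>An automorphism of \<open>L\<close> is determined by its values at \<open>\<zeta>\<close> and at a primitive element of \<open>F\<close>.\<close>

lemma finite_GalL: "finite GalL"
proof -
  obtain \<theta> where \<theta>: "\<theta> \<in> F" "inj_on (\<lambda>\<rho>. \<rho> \<theta>) Gal" by (rule galF.exists_distinct_conjugates)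
  have \<theta>L: "\<theta> \<in> L" using \<theta>(1) F_subset by blast
  obtain P where P: "P \<noteq> 0" "ieval P \<theta> = 0" using algebraicE'[OF alg] by (metis ieval_def)
  define A where "A = {x::'a. ieval P x = 0} \<times> {x::'a. x ^ p = 1}"
  have "finite {x::'a. x ^ p = 1}"
  proof (rule finite_subset)
    show "{x::'a. x ^ p = 1} \<subseteq> (\<lambda>k. \<zeta> ^ k) ` {..<p}"
      using root_of_unity_is_power[OF zeta] by auto
  qed simp
  then have "finite A"
    using P(1) by (simp add: A_def ieval_def poly_roots_finite map_poly_eq_0_iff)
  moreover have "(\<lambda>\<sigma>. (\<sigma> \<theta>, \<sigma> \<zeta>)) ` GalL \<subseteq> A"
  proof clarify
    fix \<sigma> assume "\<sigma> \<in> GalL"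
    then interpret S: field_endo L \<sigma> by (rule GalL_endo)
    have "ieval P (\<sigma> \<theta>) = 0" using S.hom_ieval[OF \<theta>L, of P] P(2) by simp
    moreover have "\<sigma> \<zeta> ^ p = 1" using S.hom_power[OF zeta_L, of p] zeta_p by simp
    ultimately show "(\<sigma> \<theta>, \<sigma> \<zeta>) \<in> A" by (simp add: A_def)
  qed
  moreover have "inj_on (\<lambda>\<sigma>. (\<sigma> \<theta>, \<sigma> \<zeta>)) GalL"
  proof (rule inj_onI)
    fix \<sigma> \<sigma>' assume G: "\<sigma> \<in> GalL" "\<sigma>' \<in> GalL" and "(\<sigma> \<theta>, \<sigma> \<zeta>) = (\<sigma>' \<theta>, \<sigma>' \<zeta>)"
    then have eq: "\<sigma> \<theta> = \<sigma>' \<theta>" "\<sigma> \<zeta> = \<sigma>' \<zeta>" by auto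
    interpret S: field_endo L \<sigma> by (rule GalL_endo) fact
    interpret S': field_endo L \<sigma>' by (rule GalL_endo) fact
    have eqF: "\<sigma> y = \<sigma>' y" if y: "y \<in> F" for y
    proof -
      obtain a b where ab: "ieval b \<theta> \<noteq> 0" "y * ieval b \<theta> = ieval a \<theta>"
        using galF.quotient_representation[OF \<theta> y] by blast
      then have "y = ieval a \<theta> / ieval b \<theta>" by (simp add: field_simps)
      then show ?thesis using \<theta>L eq(1)
        by (simp add: S.hom_divide S'.hom_divide S.hom_ieval S'.hom_ieval)
    qed
    show "\<sigma> = \<sigma>'"
    proof (rule galois_group_eqI[OF L.field_set_axioms G])
      fix x assume "x \<in> L"
      then obtain f where f: "\<And>k. f k \<in> F" "x = comb f" unfolding L_eq by blast
      have "f k \<in> L" for k using f F_subset by blast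
      then show "\<sigma> x = \<sigma>' x"
        unfolding f(2) using zeta_L eq(2) eqF f(1) by (simp add: S.hom_combination S'.hom_combination)
    qed
  qed
  ultimately show ?thesis using finite_imageD finite_subset by blast
qed

sublocale galL: galois_over_Rats L GalL
  using L.field_set_axioms finite_GalL fixed_L by (rule galois_over_Rats_galois_group)

lemma finite_GalK: "finite GalK"
  using finite_GalL GalK_subset finite_subset by blast

text \<open>The restriction to \<open>L\<close> is what makes the composite a member of the group as
  encoded.\<close>

definition tau_translate :: "nat \<times> ('a \<Rightarrow> 'a) \<Rightarrow> 'a \<Rightarrow> 'a" where
  "tau_translate = (\<lambda>(j, \<sigma>). \<lambda>x\<in>L. (\<tau> ^^ j) (\<sigma> x))"

lemma tau_translate_GalL:
  assumes "\<sigma> \<in> GalL" shows "tau_translate (j, \<sigma>) \<in> GalL"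
proof (induction j)
  case 0
  have "tau_translate (0, \<sigma>) = \<sigma>"
    using assms by (auto simp: tau_translate_def mem_galois_group_iff[OF L.field_set_axioms] extensional_def)
  then show ?case using assms by simp
next
  case (Suc j)
  have "tau_translate (Suc j, \<sigma>) = compose L \<tau> (tau_translate (j, \<sigma>))"
    by (auto simp: tau_translate_def compose_def)
  then show ?case using galois_group_compose[OF L.field_set_axioms L.Rats_subset tau_GalL Suc] by simp
qed

lemma GalK_iff: "\<sigma> \<in> GalK \<longleftrightarrow> \<sigma> \<in> GalL \<and> \<sigma> \<zeta> = \<zeta>"
proof
  assume \<sigma>: "\<sigma> \<in> GalL \<and> \<sigma> \<zeta> = \<zeta>"
  then interpret S: field_endo L \<sigma> using GalL_endo by blast
  have "field_set {x \<in> L. \<sigma> x = x}"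
    by unfold_locales (auto simp: S.hom_minus S.hom_add S.hom_mult S.hom_inverse)
  then have "K \<subseteq> {x \<in> L. \<sigma> x = x}"
    unfolding K using \<sigma> zeta_L by (intro generate_field_minimal) auto
  then show "\<sigma> \<in> GalK" using \<sigma> by (auto simp: mem_galois_group_iff[OF L.field_set_axioms])
qed (use GalK_subset GalK_zeta in auto)

text \<open>The coset decomposition modulo \<open>GalK\<close>. The exponent \<open>j\<close> is
  read off from the image of \<open>\<zeta>\<close>, and since \<open>e\<close> is a primitive root
  each possible image occurs for exactly one \<open>j < p - 1\<close>.\<close>

lemma bij_tau_translate: "bij_betw tau_translate ({..<p - 1} \<times> GalK) GalL"
  unfolding bij_betw_def
proof
  have at_zeta: "tau_translate (j, \<sigma>) \<zeta> = \<zeta> ^ (e ^ j)" if "\<sigma> \<in> GalK" for j \<sigma>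
    using that zeta_L by (simp add: tau_translate_def GalK_zeta tau_power_zeta)
  show "inj_on tau_translate ({..<p - 1} \<times> GalK)"
  proof (rule inj_onI, clarify)
    fix i j \<sigma> \<sigma>' assume ij: "i < p - 1" "j < p - 1" and G: "\<sigma> \<in> GalK" "\<sigma>' \<in> GalK"
      and eq: "tau_translate (i, \<sigma>) = tau_translate (j, \<sigma>')"
    have "\<zeta> ^ (e ^ i) = \<zeta> ^ (e ^ j)" using at_zeta G eq by metis
    then have "e ^ i mod p = e ^ j mod p" using primitive_root_power_eq_iff[OF zeta] by blast
    then have [simp]: "i = j" using exponent_bij ij by (auto simp: bij_betw_def inj_on_def)
    interpret J: field_endo L "\<tau> ^^ j" by (rule tau_power_endo)
    have "\<sigma> x = \<sigma>' x" if "x \<in> L" for x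
    proof -
      have "(\<tau> ^^ j) (\<sigma> x) = (\<tau> ^^ j) (\<sigma>' x)"
        using fun_cong[OF eq, of x] that by (simp add: tau_translate_def)
      moreover have "\<sigma> x \<in> L" "\<sigma>' x \<in> L" using G GalK_subset that galL.conjugate_closed by blast+
      ultimately show ?thesis by (simp add: J.hom_inj)
    qed
    then show "i = j \<and> \<sigma> = \<sigma>'" using galois_group_eqI[OF L.field_set_axioms G] by simp
  qed
  show "tau_translate ` ({..<p - 1} \<times> GalK) = GalL"
  proof
    show "tau_translate ` ({..<p - 1} \<times> GalK) \<subseteq> GalL" using tau_translate_GalL GalK_subset by auto
    show "GalL \<subseteq> tau_translate ` ({..<p - 1} \<times> GalK)"
    proof
      fix g assume g: "g \<in> GalL"
      then interpret g: field_endo L g by (rule GalL_endo)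
      have "g \<zeta> ^ p = 1" using g.hom_power[OF zeta_L, of p] zeta_p by simp
      then obtain a where a: "a < p" "g \<zeta> = \<zeta> ^ a" using root_of_unity_is_power[OF zeta] by blast
      have "\<zeta> \<noteq> 1" using primitive_root_power_eq_1_iff[OF zeta, of 1] p_gt_1 by auto
      then have "g \<zeta> \<noteq> g 1" using g.hom_inj[OF zeta_L L.one_closed] by blast
      then have "a > 0" using a by (intro Nat.gr0I) auto
      then obtain j where j: "j < p - 1" "\<zeta> ^ (e ^ j) = \<zeta> ^ a" using exponent_exists a by blast
      define t where "t = tau_translate (j, restrict id L)"
      have t: "t \<in> GalL" unfolding t_def
        by (intro tau_translate_GalL galois_group_id L.field_set_axioms L.Rats_subset)
      have tx: "t x = (\<tau> ^^ j) x" if "x \<in> L" for x using that by (simp add: t_def tau_translate_def)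
      obtain t' where t': "t' \<in> GalL" "\<And>x. x \<in> L \<Longrightarrow> t' (t x) = x \<and> t (t' x) = x"
        using galois_group_inverse[OF L.field_set_axioms L.Rats_subset t] by blast
      define \<sigma> where "\<sigma> = compose L t' g"
      have "\<sigma> \<in> GalL" unfolding \<sigma>_def
        using galois_group_compose[OF L.field_set_axioms L.Rats_subset t'(1) g] .
      moreover have "\<sigma> \<zeta> = \<zeta>"
        using zeta_L t'(2)[OF zeta_L] tx[OF zeta_L] a j by (simp add: \<sigma>_def compose_def tau_power_zeta)
      ultimately have "\<sigma> \<in> GalK" by (simp add: GalK_iff)
      moreover have "tau_translate (j, \<sigma>) = g"
      proof (rule galois_group_eqI[OF L.field_set_axioms _ g])
        show "tau_translate (j, \<sigma>) \<in> GalL" by (rule tau_translate_GalL) fact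
        fix x assume x: "x \<in> L"
        have "t' (g x) \<in> L" using x t'(1) GalL_endo field_endo.maps g.maps by blast
        then show "tau_translate (j, \<sigma>) x = g x"
          using x t'(2)[of "g x"] tx[of "t' (g x)"] by (simp add: tau_translate_def \<sigma>_def compose_def)
      qed
      ultimately show "g \<in> tau_translate ` ({..<p - 1} \<times> GalK)" using j(1) by (intro image_eqI) auto
    qed
  qed
qed

section \<open>The norm and the homomorphism Phi on L\<close>

abbreviation "N \<equiv> galois_norm L K"
abbreviation "\<Phi> \<equiv> Phi p e \<tau>"

lemma GalK_endo: "\<sigma> \<in> GalK \<Longrightarrow> field_endo L \<sigma>"
  using GalL_endo GalK_subset by blast

lemma norm_closed: "x \<in> L - {0} \<Longrightarrow> N x \<in> L - {0}"
  using field_endo.maps[OF GalK_endo] field_endo.hom_eq_0_iff[OF GalK_endo] finite_GalK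
  by (auto simp: galois_norm_def prod_zero_iff intro!: L.prod_closed)

lemma norm_mult: "x \<in> L \<Longrightarrow> y \<in> L \<Longrightarrow> N (x * y) = N x * N y"
  using field_endo.hom_mult[OF GalK_endo]
  by (simp add: galois_norm_def prod.distrib[symmetric] cong: prod.cong)

lemma norm_power: "x \<in> L \<Longrightarrow> N (x ^ n) = N x ^ n"
  using field_endo.hom_power[OF GalK_endo]
  by (simp add: galois_norm_def prod_power_distrib cong: prod.cong)

lemma Phi_closed: "y \<in> L - {0} \<Longrightarrow> \<Phi> y \<in> L - {0}"
  using field_endo.hom_eq_0_iff[OF tau_power_endo]
  by (auto simp: Phi_def tau_power_closed prod_zero_iff intro!: L.prod_closed)

lemma Phi_mult: "x \<in> L \<Longrightarrow> y \<in> L \<Longrightarrow> \<Phi> (x * y) = \<Phi> x * \<Phi> y"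
  using field_endo.hom_mult[OF tau_power_endo] by (simp add: Phi_def prod.distrib power_mult_distrib)

lemma Phi_power: "x \<in> L \<Longrightarrow> \<Phi> (x ^ n) = \<Phi> x ^ n"
  using field_endo.hom_power[OF tau_power_endo]
  by (simp add: Phi_def prod_power_distrib mult.commute flip: power_mult)

text \<open>Each of the \<open>p - 1\<close> factors has the same exponent, because
  \<open>e ^ j * e ^ (p - 2 - j)\<close> does not depend on \<open>j\<close>.\<close>

lemma Phi_zeta: "\<Phi> \<zeta> = \<zeta> ^ ((p - 1) * e ^ (p - 2))"
proof -
  have "\<Phi> \<zeta> = (\<Prod>j = 0..p - 2. \<zeta> ^ (e ^ (p - 2)))"
    unfolding Phi_def
  proof (rule prod.cong)
    fix j assume "j \<in> {0..p - 2}"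
    then have "j + (p - 2 - j) = p - 2" by simp
    then have "e ^ j * e ^ (p - 2 - j) = e ^ (p - 2)" by (metis power_add)
    then show "(\<tau> ^^ j) \<zeta> ^ e ^ (p - 2 - j) = \<zeta> ^ e ^ (p - 2)" by (simp add: tau_power_zeta flip: power_mult)
  qed simp
  also have "\<dots> = \<zeta> ^ ((p - 1) * e ^ (p - 2))"
  proof -
    have "card {0..p - 2} = p - 1" using p_gt_1 by simp
    then show ?thesis by (simp only: prod_constant mult.commute flip: power_mult)
  qed
  finally show ?thesis .
qed

lemma nth_powers_divide:
  assumes "z ^ p * c \<in> nth_powers p L" "z \<in> L - {0}"
  shows "c \<in> nth_powers p L"
proof -
  obtain y where y: "y \<in> L - {0}" "z ^ p * c = y ^ p" using assms(1) by (auto simp: nth_powers_def)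
  then have "c = (y / z) ^ p" using assms(2) by (simp add: power_divide field_simps)
  moreover have "y / z \<in> L - {0}" using y assms(2) by simp
  ultimately show ?thesis by (auto simp: nth_powers_def)
qed

lemma nth_powers_mult: "z \<in> L - {0} \<Longrightarrow> c \<in> nth_powers p L \<Longrightarrow> z ^ p * c \<in> nth_powers p L"
  by (auto simp: nth_powers_def power_mult_distrib[symmetric])

lemma induces_both_power_mult:
  assumes "z \<in> L - {0}" "x \<in> L - {0}" "induces_Heisenberg p e \<tau> L K x" "induces_semidirect p e \<tau> \<zeta> L K x"
  shows "induces_Heisenberg p e \<tau> L K (z ^ p * x)" "induces_semidirect p e \<tau> \<zeta> L K (z ^ p * x)"
proof -
  have z: "\<Phi> (N z) \<in> L - {0}" using assms(1) by (intro Phi_closed norm_closed)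
  have x: "N x \<in> L - {0}" "N z \<in> L - {0}" using assms(1,2) by (auto intro!: norm_closed simp del: Diff_iff)
  have "N (z ^ p * x) = N z ^ p * N x" using assms by (simp add: norm_mult norm_power)
  then have "\<Phi> (N (z ^ p * x)) = \<Phi> (N z) ^ p * \<Phi> (N x)"
    "\<Phi> (\<zeta> * N (z ^ p * x)) = \<Phi> (N z) ^ p * \<Phi> (\<zeta> * N x)"
    using x zeta_L by (simp_all add: Phi_mult Phi_power)
  then show "induces_Heisenberg p e \<tau> L K (z ^ p * x)" "induces_semidirect p e \<tau> \<zeta> L K (z ^ p * x)"
    using assms(3,4) nth_powers_divide z
    by (auto simp: induces_Heisenberg_def induces_semidirect_def simp del: Diff_iff)
qed

lemma exists_inducing_both:
  "\<exists>x\<in>L - {0}. induces_Heisenberg p e \<tau> L K x \<and> induces_semidirect p e \<tau> \<zeta> L K x"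
proof -
  obtain v x where v: "\<And>x y. x \<in> L - {0} \<Longrightarrow> y \<in> L - {0} \<Longrightarrow> v (x * y) = v x + v y"
    and x: "x \<in> L - {0}" "\<And>\<sigma>. \<sigma> \<in> GalL \<Longrightarrow> (v (\<sigma> x) :: int) \<ge> 0" "(\<Sum>\<sigma>\<in>GalL. v (\<sigma> x)) = 1"
    by (rule galL.exists_valuation[OF alg]) blast
  have v': "\<forall>x\<in>L - {0}. \<forall>y\<in>L - {0}. v (x * y) = v x + v y" using v by blast
  have v1: "v 1 = 0" by (rule L.valuation_one[OF v'])
  note v_prod = L.valuation_prod[OF v'] and v_power = L.valuation_power[OF v']
  \<comment> \<open>By the coset decomposition these numbers add up to the sum of the valuations of
    all conjugates of \<open>x\<close>, which is 1. Being nonnegative, exactly one of them is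
    1.\<close>
  define w where "w j = v ((\<tau> ^^ j) (N x))" for j
  have nz: "\<sigma> x \<in> L - {0}" if "\<sigma> \<in> GalL" for \<sigma>
    using field_endo.maps[OF GalL_endo[OF that]] field_endo.hom_eq_0_iff[OF GalL_endo[OF that]] x(1) by simp
  have w: "w j = (\<Sum>\<sigma>\<in>GalK. v (tau_translate (j, \<sigma>) x))" for j
  proof -
    interpret J: field_endo L "\<tau> ^^ j" by (rule tau_power_endo)
    have "(\<tau> ^^ j) (N x) = (\<Prod>\<sigma>\<in>GalK. (\<tau> ^^ j) (\<sigma> x))"
      unfolding galois_norm_def using nz GalK_subset by (intro J.hom_prod) auto
    also have "\<dots> = (\<Prod>\<sigma>\<in>GalK. tau_translate (j, \<sigma>) x)"
      using x(1) by (simp add: tau_translate_def)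
    finally have "w j = v (\<Prod>\<sigma>\<in>GalK. tau_translate (j, \<sigma>) x)" by (simp add: w_def)
    also have "\<dots> = (\<Sum>\<sigma>\<in>GalK. v (tau_translate (j, \<sigma>) x))"
      using finite_GalK tau_translate_GalL GalK_subset nz by (intro v_prod) blast+
    finally show ?thesis .
  qed
  have "(\<Sum>j<p - 1. w j) = (\<Sum>(j, \<sigma>)\<in>{..<p - 1} \<times> GalK. v (tau_translate (j, \<sigma>) x))"
    unfolding w by (rule sum.cartesian_product)
  also have "\<dots> = (\<Sum>i\<in>{..<p - 1} \<times> GalK. v (tau_translate i x))" by (intro sum.cong) auto
  also have "\<dots> = 1" using sum.reindex_bij_betw[OF bij_tau_translate, of "\<lambda>\<sigma>. v (\<sigma> x)"] x(3) by simp
  finally have sum_w: "(\<Sum>j<p - 1. w j) = 1" .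
  have w_nonneg: "w j \<ge> 0" for j
    unfolding w using x(2) tau_translate_GalL GalK_subset by (intro sum_nonneg) blast
  obtain i where i: "i < p - 1" "w i = 1" "\<And>j. j < p - 1 \<Longrightarrow> j \<noteq> i \<Longrightarrow> w j = 0"
    using sum_eq_1_nonneg_int[OF _ w_nonneg sum_w] by auto
  have Nx: "N x \<in> L - {0}" using x(1) by (rule norm_closed)
  have tN: "(\<tau> ^^ j) (N x) \<in> L - {0}" for j
    using field_endo.hom_eq_0_iff[OF tau_power_endo] Nx by (auto simp: tau_power_closed)
  \<comment> \<open>The exponents in \<open>\<Phi>\<close> become the weights of the
    \<open>w j\<close>, so only the weight at \<open>i\<close> remains.\<close>
  have "v (\<Phi> (N x)) = (\<Sum>j = 0..p - 2. int (e ^ (p - 2 - j)) * w j)"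
    unfolding Phi_def w_def using tN by (subst v_prod) (auto simp: v_power simp del: of_nat_power)
  also have "\<dots> = int (e ^ (p - 2 - i))"
    using i p_gt_1 by (subst sum.remove[of _ i]) (auto intro!: sum.neutral i(3))
  finally have v_Phi: "v (\<Phi> (N x)) = int (e ^ (p - 2 - i))" .
  have ndvd: "\<not> p dvd e ^ (p - 2 - i)"
    using coprime_e p_gt_1 p(1) prime_dvd_power by (metis coprime_common_divisor_nat dvd_refl less_irrefl)
  \<comment> \<open>The factor \<open>c\<close> treats both conditions at once: it will be 1 and
    \<open>\<Phi> \<zeta>\<close>, and a \<open>p\<close>-th root of unity has valuation 0.\<close>
  have not_power: "c * \<Phi> (N x) \<notin> nth_powers p L" if c: "c \<in> L" "c ^ p = 1" for c
  proof
    assume "c * \<Phi> (N x) \<in> nth_powers p L"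
    then obtain y where y: "y \<in> L - {0}" "c * \<Phi> (N x) = y ^ p" by (auto simp: nth_powers_def)
    have c0: "c \<in> L - {0}" using c p_gt_0 by (auto simp: power_0_left)
    have "v c = 0" using v_power[OF c0, of p] c v1 p_gt_0 by simp
    then have "int (e ^ (p - 2 - i)) = int p * v y"
      using v[OF c0 Phi_closed[OF Nx]] v_power[OF y(1), of p] y(2) v_Phi by simp
    then have "int p dvd int (e ^ (p - 2 - i))" by simp
    then have "p dvd e ^ (p - 2 - i)" by (simp only: int_dvd_int_iff)
    then show False using ndvd by blast
  qed
  have "\<Phi> (\<zeta> * N x) = \<Phi> \<zeta> * \<Phi> (N x)" using Nx zeta_L by (simp add: Phi_mult)
  moreover have "\<Phi> \<zeta> ^ p = 1"
    unfolding Phi_zeta using primitive_root_power_eq_1_iff[OF zeta] by (simp flip: power_mult)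
  moreover have "\<Phi> \<zeta> \<in> L" unfolding Phi_zeta using zeta_L by simp
  ultimately show ?thesis
    using x(1) not_power[of 1] not_power[of "\<Phi> \<zeta>"]
    by (intro bexI[of _ x]) (auto simp: induces_Heisenberg_def induces_semidirect_def)
qed

theorem infinitely_many_inducing_both:
  "infinite {x \<in> L - {0}. induces_Heisenberg p e \<tau> L K x \<and> induces_semidirect p e \<tau> \<zeta> L K x}"
proof -
  obtain x where x: "x \<in> L - {0}" "induces_Heisenberg p e \<tau> L K x" "induces_semidirect p e \<tau> \<zeta> L K x"
    using exists_inducing_both by blast
  \<comment> \<open>Positive integers serve as the \<open>p\<close>-th power multipliers: they are
    nonzero in characteristic 0, and distinct ones have distinct \<open>p\<close>-th powers.\<close>
  define h where "h k = of_nat (Suc k) ^ p * x" for k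
  have "inj h"
  proof (rule injI)
    fix k l assume "h k = h l"
    then have "(of_nat (Suc k ^ p) :: 'a) = of_nat (Suc l ^ p)" using x(1) by (simp add: h_def del: of_nat_Suc)
    then have "Suc k ^ p = Suc l ^ p" by (simp only: of_nat_eq_iff)
    then show "k = l" using p_gt_0 by (simp add: power_eq_iff_eq_base)
  qed
  then have "infinite (range h)" by (rule range_inj_infinite)
  moreover have "range h \<subseteq> {x \<in> L - {0}. induces_Heisenberg p e \<tau> L K x \<and> induces_semidirect p e \<tau> \<zeta> L K x}"
  proof
    fix y assume "y \<in> range h"
    then obtain k where k: "y = of_nat (Suc k) ^ p * x" by (auto simp: h_def)
    have z: "of_nat (Suc k) \<in> L - {0}" by (simp del: of_nat_Suc)
    then show "y \<in> {x \<in> L - {0}. induces_Heisenberg p e \<tau> L K x \<and> induces_semidirect p e \<tau> \<zeta> L K x}"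
      using induces_both_power_mult[OF z x] x(1) k by (simp del: of_nat_Suc)
  qed
  ultimately show ?thesis using finite_subset by blast
qed

end

section \<open>When the root of unity becomes a power\<close>

lemma (in galois_over_Rats) trace_rational:
  assumes "x \<in> E" shows "(\<Sum>\<rho>\<in>G. \<rho> x) \<in> \<rat>"
proof (rule fixed_Rats)
  show "(\<Sum>\<rho>\<in>G. \<rho> x) \<in> E" by (rule sum_closed) (rule conjugate_closed[OF _ assms])
  fix \<sigma> assume \<sigma>: "\<sigma> \<in> G"
  then interpret S: field_endo E \<sigma> by (rule endo)
  obtain m where m: "bij_betw m G G" "\<And>\<rho> x. \<rho> \<in> G \<Longrightarrow> x \<in> E \<Longrightarrow> m \<rho> x = \<sigma> (\<rho> x)"
    using left_translation[OF \<sigma>] by blast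
  have "\<sigma> (\<Sum>\<rho>\<in>G. \<rho> x) = (\<Sum>\<rho>\<in>G. \<sigma> (\<rho> x))"
    by (rule S.hom_sum) (rule conjugate_closed[OF _ assms])
  also have "\<dots> = (\<Sum>\<rho>\<in>G. m \<rho> x)" using m(2) assms by (intro sum.cong) auto
  also have "\<dots> = (\<Sum>\<rho>\<in>G. \<rho> x)" by (rule sum.reindex_bij_betw[OF m(1)])
  finally show "\<sigma> (\<Sum>\<rho>\<in>G. \<rho> x) = (\<Sum>\<rho>\<in>G. \<rho> x)" .
qed

lemma generate_primitive_root_cong:
  fixes y \<xi> :: "'a::field_char_0"
  assumes "primitive_root_of_unity n y" "primitive_root_of_unity n \<xi>"
  shows "generate_field ambient {y} = generate_field ambient {\<xi>}"
proof -
  have *: "generate_field ambient {a} \<subseteq> generate_field ambient {b}"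
    if ab: "primitive_root_of_unity n a" "primitive_root_of_unity n b" for a b :: 'a
  proof (rule generate_field_minimal)
    interpret B: field_set "generate_field ambient {b}" by (rule field_set_generate)
    obtain k where "a = b ^ k"
      using root_of_unity_is_power[OF ab(2), of a] ab(1) by (auto simp: primitive_root_of_unity_def)
    moreover have "b \<in> generate_field ambient {b}" using generate_field_contains by blast
    ultimately show "{a} \<subseteq> generate_field ambient {b}" by simp
  qed (rule field_set_generate)
  show ?thesis using *[OF assms] *[OF assms(2,1)] by blast
qed

section \<open>Roots of the equation y^p = zeta in K and in L\<close>

context cyclic_kummer_setup
begin

text \<open>Division by the monic \<open>C\<close> leaves a remainder vanishing at
  \<open>\<zeta>\<close>. Its coefficients below \<open>p\<close> are all equal by disjointness, and
  the one at \<open>p - 1\<close> is 0 for reasons of degree, so \<open>C\<close> divides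
  \<open>g\<close>.\<close>

lemma cyclotomic_value_dvd:
  assumes "ieval g \<zeta> = 0"
  shows "(\<Sum>k<p. n ^ k) dvd poly g n"
proof -
  define C :: "int poly" where "C = (\<Sum>k<p. monom 1 k)"
  have coeffC: "coeff C i = (if i < p then 1 else 0)" for i by (simp add: C_def coeff_sum)
  have degC: "degree C = p - 1"
  proof (rule antisym)
    show "degree C \<le> p - 1" by (rule degree_le) (auto simp: coeffC)
    show "p - 1 \<le> degree C" using p_gt_0 by (intro le_degree) (simp add: coeffC)
  qed
  have leadC: "coeff C (degree C) = 1" using p_gt_0 by (simp add: degC coeffC)
  then have "C \<noteq> 0" by auto
  obtain h r where hr: "pseudo_divmod g C = (h, r)" by fastforce
  have g: "g = C * h + r" using pseudo_divmod(1)[OF \<open>C \<noteq> 0\<close> hr] leadC by simp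
  have degr: "r = 0 \<or> degree r < p - 1" using pseudo_divmod(2)[OF \<open>C \<noteq> 0\<close> hr] degC by simp
  have coeffr: "coeff r k = 0" if "k \<ge> p - 1" for k
    using degr that by (auto intro: coeff_eq_0)
  have "ieval C \<zeta> = 0" using sum_zeta_powers by (simp add: C_def)
  then have "ieval r \<zeta> = 0" using assms g by simp
  have "comb (\<lambda>k. of_int (coeff r k)) = ieval r \<zeta>"
  proof (cases "r = 0")
    case False
    then have "{..degree r} \<subseteq> {..<p}" using degr by auto
    then show ?thesis unfolding combination_def ieval_altdef
      by (intro sum.mono_neutral_right) (auto simp: coeff_eq_0)
  qed (simp add: combination_def)
  then have 0: "comb (\<lambda>k. of_int (coeff r k)) = 0" using \<open>ieval r \<zeta> = 0\<close> by simp
  have "coeff r k = 0" for k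
  proof (cases "k < p")
    case True
    have "(of_int (coeff r k) :: 'a) = of_int (coeff r (p - 1))"
      by (rule comb_eq_0_imp_constant[OF _ 0 True]) (use p_gt_0 in auto)
    then show ?thesis using coeffr[of "p - 1"] by simp
  qed (use coeffr in simp)
  then have "r = 0" by (simp add: poly_eq_iff)
  have "poly C n = (\<Sum>k<p. n ^ k)" by (simp add: C_def poly_sum poly_monom)
  then show ?thesis using g \<open>r = 0\<close> by (metis add.right_neutral dvd_triv_left poly_mult)
qed

text \<open>Reduce modulo a prime divisor of the cyclotomic value \<open>1 + n + \<dots> + n\<^sup>p\<^sup>-\<^sup>1\<close> that is not
  congruent to 1 modulo \<open>p\<^sup>2\<close>: a primitive \<open>p\<^sup>2\<close>-th root of unity in \<open>K\<close> has no image in the residue field.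
  The choice of \<open>n\<close> avoids the primes that divide the denominator \<open>D\<close>.\<close>

lemma zeta_not_power_in_K:
  assumes y: "y \<in> K" shows "y ^ p \<noteq> \<zeta>"
proof
  assume yp: "y ^ p = \<zeta>"
  obtain f where f: "\<And>k. f k \<in> \<rat>" "y = comb f" using y unfolding K_eq by blast
  define P where "P = (\<Sum>k<p. monom (f k) k)"
  have coeffP: "coeff P i \<in> \<rat>" for i
    using f(1) by (auto simp: P_def coeff_sum)
  obtain D R where DR: "D > 0" "smult (of_int D) P = map_poly of_int R"
    using rat_poly_clear_denominators[of P] coeffP by blast
  have "poly P \<zeta> = y" by (simp add: P_def poly_sum poly_monom f(2) combination_def)
  then have R: "ieval R \<zeta> = of_int D * y" by (simp add: ieval_def flip: DR(2))
  define d where "d = nat D"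
  have d: "d > 0" "int d = D" using DR(1) by (auto simp: d_def)
  obtain D' where D': "d = p ^ multiplicity p d * D'" "\<not> p dvd D'"
    using multiplicity_decompose'[of d p] d p by (metis not_prime_unit neq0_conv)
  \<comment> \<open>Every prime factor of \<open>d\<close> divides \<open>n\<close>, while
    \<open>S\<close> is 1 modulo \<open>n\<close>; hence no prime factor of \<open>S\<close> divides
    the denominator. As \<open>n\<close> contains \<open>p\<close> exactly once, \<open>S\<close>,
    which is \<open>1 + n\<close> modulo \<open>p\<^sup>2\<close>, cannot be 1 there.\<close>
  define n where "n = p * D'"
  have n0: "n > 0" using D' d p_gt_0 by (auto simp: n_def intro!: Nat.gr0I)
  define S where "S = (\<Sum>k<p. n ^ k)"
  have S: "S > 0" using p_gt_0 n0 by (auto simp: S_def intro!: sum_pos)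
  have geometric: "int S * (int n - 1) = int n ^ p - 1"
    using power_diff_sumr2[of "int n" p 1] by (simp add: S_def mult.commute)
  have "[S = 1] (mod p\<^sup>2)"
  proof (rule cong_1_if_prime_factors_cong_1[OF S])
    fix q assume q: "prime q" "q dvd S"
    have S_split: "S = 1 + n * (\<Sum>k<p - 1. n ^ k)"
    proof -
      have "p = Suc (p - 1)" using p_gt_0 by simp
      then have "S = (\<Sum>k<Suc (p - 1). n ^ k)" by (simp add: S_def)
      also have "\<dots> = 1 + n * (\<Sum>k<p - 1. n ^ k)"
        by (subst sum.lessThan_Suc_shift) (simp add: sum_distrib_left)
      finally show ?thesis .
    qed
    have qn: "\<not> q dvd n"
    proof
      assume "q dvd n"
      then have "q dvd 1" using q(2) unfolding S_split by (metis dvd_add_left_iff dvd_mult2)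
      then show False using q(1) not_prime_unit by blast
    qed
    have "\<not> q dvd d"
    proof
      assume "q dvd d"
      then have "q dvd p ^ multiplicity p d \<or> q dvd D'" using D'(1) q(1) prime_dvd_mult_iff by metis
      then have "q dvd p \<or> q dvd D'" using q(1) prime_dvd_power by blast
      then show False using qn by (auto simp: n_def)
    qed
    then have "coprime d q" using q(1) prime_imp_coprime coprime_commute by blast
    then obtain d' where d': "[int d * d' = 1] (mod int q)"
      using cong_solve_coprime_int[of "int d" "int q"] by auto
    have "int q dvd int S" using q(2) by simp
    also have "int S = (\<Sum>k<p. int n ^ k)" by (simp add: S_def)
    \<comment> \<open>This polynomial vanishes at \<open>\<zeta>\<close> because \<open>R\<close>
      takes the value \<open>D * y\<close> there and \<open>y ^ p = \<zeta>\<close>. Evaluation at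
      \<open>n\<close> carries that equation to the residues modulo \<open>q\<close>.\<close>
    also have "\<dots> dvd poly (R ^ p - smult (D ^ p) (monom 1 1)) (int n)"
      by (rule cyclotomic_value_dvd) (simp add: R power_mult_distrib yp)
    finally have "[poly R (int n) ^ p = D ^ p * int n] (mod int q)"
      by (simp add: cong_iff_dvd_diff poly_monom)
    \<comment> \<open>As \<open>d'\<close> inverts the denominator modulo \<open>q\<close>, the
      product \<open>poly R (int n) * d'\<close> is the residue of \<open>y\<close>; its
      \<open>p\<close>-th power is the residue \<open>n\<close> of \<open>\<zeta>\<close>.\<close>
    then have "[poly R (int n) ^ p * d' ^ p = D ^ p * int n * d' ^ p] (mod int q)"
      by (rule cong_mult) simp
    moreover have "[(int d * d') ^ p * int n = 1 ^ p * int n] (mod int q)"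
      by (intro cong_mult cong_pow d') simp
    ultimately have s: "[(poly R (int n) * d') ^ p = int n] (mod int q)"
      using d(2) by (simp add: power_mult_distrib mult_ac cong_def)
    define s where "s = nat ((poly R (int n) * d') mod int q)"
    have "int s = (poly R (int n) * d') mod int q"
      using prime_gt_0_nat[OF q(1)] by (simp add: s_def)
    then have "[int s = poly R (int n) * d'] (mod int q)" by simp
    from cong_trans[OF cong_pow[OF this] s] have "[int (s ^ p) = int n] (mod int q)" by simp
    then have sp: "[s ^ p = n] (mod q)" by (simp only: cong_int_iff)
    have "int q dvd int n ^ p - 1" using q(2) geometric by (metis dvd_mult2 int_dvd_int_iff)
    then have "[int (n ^ p) = int 1] (mod int q)" by (simp add: cong_iff_dvd_diff)
    then have np: "[n ^ p = 1] (mod q)" by (simp only: cong_int_iff)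
    have n1: "\<not> [n = 1] (mod q)"
    proof
      assume 1: "[n = 1] (mod q)"
      have "[(\<Sum>k<p. n ^ k) = (\<Sum>k<p. 1 ^ k)] (mod q)" by (intro cong_sum cong_pow 1)
      then have "[S = p] (mod q)" by (simp add: S_def)
      then have "q dvd p" using q(2) cong_dvd_iff by blast
      then show False using qn by (simp add: n_def)
    qed
    show "[q = 1] (mod p\<^sup>2)" by (rule cong_1_mod_prime_square[OF p(1) q(1) sp np n1])
  qed
  moreover have "[S = 1 + n] (mod p\<^sup>2)"
  proof -
    have "p = Suc (Suc (p - 2))" using p_gt_1 by simp
    then have "S = (\<Sum>k<Suc (Suc (p - 2)). n ^ k)" by (simp add: S_def)
    also have "\<dots> = 1 + n + n\<^sup>2 * (\<Sum>k<p - 2. n ^ k)"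
      by (simp only: sum.lessThan_Suc_shift) (simp add: sum_distrib_left power2_eq_square mult.assoc)
    finally have "S = 1 + n + p\<^sup>2 * (D'\<^sup>2 * (\<Sum>k<p - 2. n ^ k))"
      by (simp add: n_def power_mult_distrib mult.assoc)
    then show ?thesis by (simp add: cong_def)
  qed
  ultimately have "[1 + n = 1 + 0] (mod p\<^sup>2)" using cong_sym cong_trans by (metis add.right_neutral)
  then have "p\<^sup>2 dvd n" by (simp only: cong_add_lcancel_nat cong_0_iff)
  then have "p dvd D'" using p_gt_0 by (simp add: n_def power2_eq_square)
  then show False using D'(2) by blast
qed

text \<open>Applying \<open>g\<close> preserves the normalisation at 0, and normalised coefficients
  are unique below \<open>p\<close>.\<close>

lemma extend_fixed_coeffs:
  assumes g: "g \<in> Gal" and f: "\<And>k. f k \<in> F" "f 0 = 0" and fixed: "extend g (comb f) = comb f" and "k < p"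
  shows "g (f k) = f k"
proof -
  interpret g: field_endo F g using Gal_endo g .
  have 0: "comb (\<lambda>k. g (f k) - f k) = 0"
    using fixed g f unfolding combination_diff[symmetric] by (simp add: extend_comb)
  have "g (f k) - f k = g (f 0) - f 0"
    by (rule comb_eq_0_imp_constant[OF _ 0 \<open>k < p\<close> p_gt_0]) (simp add: f)
  then show ?thesis using f(2) by simp
qed

text \<open>The stabiliser of \<open>y\<close> fixes the normalised coefficients of
  \<open>y\<close>. If its fixed field in \<open>F\<close> were only the rationals, \<open>y\<close>
  would lie in \<open>K\<close>, which is impossible; as the degree is prime, the fixed field is all
  of \<open>F\<close>.\<close>

lemma extend_pth_root_stabilizer:
  assumes y: "y \<in> L" "y ^ p = \<zeta>" and g: "g \<in> Gal" "extend g y = y" and x: "x \<in> L"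
  shows "extend g x = x"
proof -
  define H where "H = {h \<in> Gal. extend h y = y}"
  define E where "E = {z \<in> F. \<forall>h\<in>H. h z = z}"
  have HG: "field_endo F h" if "h \<in> H" for h using that Gal_endo by (simp add: H_def)
  have "field_set E"
  proof
    fix a b assume ab: "a \<in> E" "b \<in> E"
    then have F: "a \<in> F" "b \<in> F" and fixed: "\<And>h. h \<in> H \<Longrightarrow> h a = a" "\<And>h. h \<in> H \<Longrightarrow> h b = b"
      by (auto simp: E_def)
    have "h (a + b) = a + b \<and> h (a * b) = a * b \<and> h (- a) = - a \<and> h (inverse a) = inverse a"
      if h: "h \<in> H" for h
    proof -
      interpret h: field_endo F h by (rule HG) fact
      show ?thesis
        using fixed[OF h] by (simp add: h.hom_add[OF F] h.hom_mult[OF F] h.hom_minus[OF F(1)] h.hom_inverse[OF F(1)])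
    qed
    then show "a + b \<in> E" "a * b \<in> E" "- a \<in> E" "inverse a \<in> E"
      using F by (simp_all add: E_def)
  qed (use field_endo.hom_1[OF HG] in \<open>simp add: E_def\<close>)
  moreover have "E \<subseteq> F" by (auto simp: E_def)
  ultimately have "E = \<rat> \<or> E = F" by (rule no_intermediate_field[OF field_F dim_F p(1)])
  moreover have "E \<noteq> \<rat>"
  proof
    assume E: "E = \<rat>"
    obtain f where f: "\<And>k. f k \<in> F" "y = comb f" "f 0 = 0" using comb_normal_form[OF y(1)] by blast
    have "f k \<in> \<rat>" if "k < p" for k
    proof -
      have "h (f k) = f k" if "h \<in> H" for h
        using that extend_fixed_coeffs[of h f k] f \<open>k < p\<close> by (auto simp: H_def)
      then have "f k \<in> E" using f(1) by (simp add: E_def)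
      then show ?thesis using E by simp
    qed
    \<comment> \<open>Coefficients at \<open>p\<close> and beyond do not enter the sum; setting them
      to 0 meets the demand of \<open>K_eq\<close> that all of them be rational.\<close>
    then have "y = comb (\<lambda>k. if k < p then f k else 0)" "\<forall>k. (if k < p then f k else 0) \<in> \<rat>"
      using f(2) by (auto simp: combination_def)
    then have "y \<in> K" unfolding K_eq by blast
    then show False using zeta_not_power_in_K y(2) by blast
  qed
  ultimately have "E = F" by blast
  then have gF: "g z = z" if "z \<in> F" for z using that g by (auto simp: E_def H_def)
  obtain f where f: "\<And>k. f k \<in> F" "x = comb f" using x unfolding L_eq by blast
  then show ?thesis using g gF by (simp add: extend_comb)
qed

text \<open>Lagrange resolvents: \<open>p x\<close> is the sum of the \<open>y\<^sup>k Tr(x / y\<^sup>k)\<close> over \<open>k < p\<close>, and the traces lie in \<open>K\<close>.\<close>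

lemma L_generated_by_pth_root:
  assumes y: "y \<in> L" "y ^ p = \<zeta>"
  shows "L = generate_field ambient {y}"
proof
  interpret Y: field_set "generate_field ambient {y}" by (rule field_set_generate)
  have yY: "y \<in> generate_field ambient {y}" using generate_field_contains by blast
  show "generate_field ambient {y} \<subseteq> L" using y(1) L.field_set_axioms by (intro generate_field_minimal) auto
  have "\<zeta> \<in> generate_field ambient {y}" using Y.power_closed[OF yY, of p] y(2) by simp
  then have KY: "K \<subseteq> generate_field ambient {y}"
    unfolding K by (intro generate_field_minimal Y.field_set_axioms) auto
  have y0: "y \<noteq> 0" using y(2) primitive_root_nonzero[OF zeta] p_gt_0 by (auto simp: power_0_left)
  show "L \<subseteq> generate_field ambient {y}"
  proof
    fix x assume x: "x \<in> L"
    define Tr where "Tr z = (\<Sum>g\<in>Gal. extend g z)" for z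
    \<comment> \<open>The trace acts on the coefficients only and turns each into a rational trace
      from \<open>F\<close>.\<close>
    have TrK: "Tr z \<in> K" if z: "z \<in> L" for z
    proof -
      obtain f where f: "\<And>k. f k \<in> F" "z = comb f" using z unfolding L_eq by blast
      have "Tr z = comb (\<lambda>k. \<Sum>g\<in>Gal. g (f k))"
        using f by (simp add: Tr_def extend_comb combination_sum)
      then show ?thesis using galF.trace_rational[OF f(1)] unfolding K_eq by blast
    qed
    \<comment> \<open>Both \<open>y\<close> and its image are \<open>p\<close>-th roots of
      \<open>\<zeta>\<close>, so this ratio is a \<open>p\<close>-th root of unity. It is 1 only for
      the identity, since the stabiliser of \<open>y\<close> is trivial, and summing its powers
      isolates the identity term.\<close>
    define \<chi> where "\<chi> g = y / extend g y" for g
    define \<iota> where "\<iota> = restrict id F"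
    have \<iota>: "\<iota> \<in> Gal" unfolding \<iota>_def by (rule galois_group_id[OF field_F F.Rats_subset])
    have sum_\<chi>: "(\<Sum>k<p. \<chi> g ^ k) = (if g = \<iota> then of_nat p else 0)" if g: "g \<in> Gal" for g
    proof (cases "g = \<iota>")
      case True
      obtain f where f: "\<And>k. f k \<in> F" "y = comb f" using y(1) unfolding L_eq by blast
      have "extend \<iota> y = y" using f \<iota> by (simp add: extend_comb \<iota>_def)
      then show ?thesis using True y0 by (simp add: \<chi>_def)
    next
      case False
      interpret E: field_endo L "extend g" by (rule extend_endo) fact
      have ey: "extend g y ^ p = \<zeta>"
        using E.hom_power[OF y(1), of p] y(2) extend_K[OF g zeta_K] by simp
      have "extend g y \<noteq> y"
      proof
        assume eq: "extend g y = y"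
        have "g z = \<iota> z" if "z \<in> F" for z
          using extend_pth_root_stabilizer[OF y g eq, of z] extend_F[OF g that] that F_subset
          by (auto simp: \<iota>_def)
        then have "g = \<iota>" by (intro galois_group_eqI[OF field_F g \<iota>])
        then show False using False by blast
      qed
      moreover have "extend g y \<noteq> 0" using y y0 E.hom_eq_0_iff by blast
      ultimately have "\<chi> g \<noteq> 1" by (simp add: \<chi>_def)
      moreover have "\<chi> g ^ p = 1"
        using ey y(2) primitive_root_nonzero[OF zeta] by (simp add: \<chi>_def power_divide)
      ultimately show ?thesis using False by (simp add: sum_powers_root_of_unity)
    qed
    have "(\<Sum>k<p. y ^ k * Tr (x / y ^ k)) = (\<Sum>k<p. \<Sum>g\<in>Gal. extend g x * \<chi> g ^ k)"
    proof (rule sum.cong)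
      fix k
      have "y ^ k * extend g (x / y ^ k) = extend g x * \<chi> g ^ k" if g: "g \<in> Gal" for g
      proof -
        interpret E: field_endo L "extend g" by (rule extend_endo) fact
        show ?thesis using x y by (simp add: E.hom_divide E.hom_power \<chi>_def power_divide)
      qed
      then show "y ^ k * Tr (x / y ^ k) = (\<Sum>g\<in>Gal. extend g x * \<chi> g ^ k)"
        by (simp add: Tr_def sum_distrib_left)
    qed simp
    also have "\<dots> = (\<Sum>g\<in>Gal. \<Sum>k<p. extend g x * \<chi> g ^ k)" by (rule sum.swap)
    also have "\<dots> = (\<Sum>g\<in>Gal. if g = \<iota> then extend g x * of_nat p else 0)"
      by (intro sum.cong refl) (simp add: sum_\<chi> flip: sum_distrib_left)
    also have "\<dots> = extend \<iota> x * of_nat p" using finite_Gal \<iota> by simp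
    also have "extend \<iota> x = x"
    proof -
      obtain f where f: "\<And>k. f k \<in> F" "x = comb f" using x unfolding L_eq by blast
      then show ?thesis using \<iota> by (simp add: extend_comb \<iota>_def)
    qed
    finally have "x = (\<Sum>k<p. y ^ k * Tr (x / y ^ k)) / of_nat p" using p_gt_0 by simp
    also have "\<dots> \<in> generate_field ambient {y}"
    proof -
      have "Tr (x / y ^ k) \<in> generate_field ambient {y}" for k
        using TrK[of "x / y ^ k"] x y KY by auto
      then show ?thesis using yY by (intro Y.divide_closed Y.sum_closed Y.mult_closed) auto
    qed
    finally show "x \<in> generate_field ambient {y}" .
  qed
qed

lemma Phi_zeta_norm: "x \<in> L - {0} \<Longrightarrow> \<Phi> (\<zeta> * N x) = \<Phi> \<zeta> * \<Phi> (N x)"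
  using norm_closed[of x] zeta_L by (simp add: Phi_mult)

text \<open>The exponent of \<open>\<zeta>\<close> in \<open>\<Phi> \<zeta>\<close> is a product of
  \<open>p - 1\<close> and a power of \<open>e\<close>, hence invertible modulo \<open>p\<close>;
  raising to the inverse recovers \<open>\<zeta>\<close>.\<close>

lemma zeta_power_if_Phi_zeta_power:
  assumes "w \<in> L" "\<Phi> \<zeta> = w ^ p"
  shows "\<exists>y\<in>L. y ^ p = \<zeta>"
proof -
  define c where "c = (p - 1) * e ^ (p - 2)"
  have "coprime (p - 1) p" using p_gt_0 by (metis coprime_diff_one_left_nat)
  then have "coprime c p" using coprime_e by (simp add: c_def)
  then obtain a where "[c * a = 1] (mod p)" using cong_solve_coprime_nat by auto
  then have "\<zeta> ^ (c * a) = \<zeta> ^ 1"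
    unfolding primitive_root_power_eq_iff[OF zeta] by (simp add: cong_def)
  moreover have "\<zeta> ^ (c * a) = (w ^ a) ^ p"
  proof -
    have "\<zeta> ^ (c * a) = (\<zeta> ^ c) ^ a" by (rule power_mult)
    also have "\<zeta> ^ c = w ^ p" using assms(2) by (simp add: Phi_zeta c_def)
    finally show ?thesis by (simp add: mult.commute flip: power_mult)
  qed
  ultimately show ?thesis using assms(1) by (intro bexI[of _ "w ^ a"]) auto
qed

lemma induces_iff_if_xi_in_L:
  assumes xi: "primitive_root_of_unity (p\<^sup>2) \<xi>" "\<xi> \<in> L" and x: "x \<in> L - {0}"
  shows "induces_Heisenberg p e \<tau> L K x \<longleftrightarrow> induces_semidirect p e \<tau> \<zeta> L K x"
proof -
  obtain k where "\<zeta> = (\<xi> ^ p) ^ k"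
    using root_of_unity_is_power[OF primitive_root_pth_power[OF p(1) xi(1)] zeta_p] by blast
  then have "\<Phi> \<zeta> = (\<xi> ^ (k * ((p - 1) * e ^ (p - 2)))) ^ p"
    unfolding Phi_zeta by (simp add: mult_ac flip: power_mult)
  moreover define z where "z = \<xi> ^ (k * ((p - 1) * e ^ (p - 2)))"
  ultimately have "\<Phi> (\<zeta> * N x) = z ^ p * \<Phi> (N x)" using x by (simp only: Phi_zeta_norm)
  moreover have "z \<in> L - {0}" using xi primitive_root_nonzero[OF xi(1)] by (simp add: z_def)
  ultimately show ?thesis
    using nth_powers_divide nth_powers_mult
    unfolding induces_Heisenberg_def induces_semidirect_def by metis
qed

text \<open>If both conditions failed, dividing the two \<open>p\<close>-th powers would give
  \<open>y ^ p = \<zeta>\<close> with \<open>y\<close> in \<open>L\<close>. Such a \<open>y\<close>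
  generates \<open>L\<close> and is a primitive root of order \<open>p\<^sup>2\<close>, and any two
  of these generate the same field.\<close>

lemma induces_one_of_both:
  assumes xi: "primitive_root_of_unity (p\<^sup>2) \<xi>" and L: "L \<noteq> generate_field ambient {\<xi>}"
    and x: "x \<in> L - {0}" "\<not> induces_Heisenberg p e \<tau> L K x"
  shows "induces_semidirect p e \<tau> \<zeta> L K x"
proof (rule ccontr)
  assume "\<not> induces_semidirect p e \<tau> \<zeta> L K x"
  then obtain w where w: "w \<in> L - {0}" "\<Phi> \<zeta> * \<Phi> (N x) = w ^ p"
    using x(1) by (auto simp: induces_semidirect_def nth_powers_def Phi_zeta_norm simp del: Diff_iff)
  obtain u where u: "u \<in> L - {0}" "\<Phi> (N x) = u ^ p"
    using x(2) by (auto simp: induces_Heisenberg_def nth_powers_def)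
  have "\<Phi> \<zeta> = (w / u) ^ p" using w u by (simp add: power_divide field_simps)
  then obtain y where y: "y \<in> L" "y ^ p = \<zeta>"
    using zeta_power_if_Phi_zeta_power[of "w / u"] w u by auto
  have "primitive_root_of_unity (p\<^sup>2) y" using primitive_root_of_prime_power[OF p(1), of y] y(2) zeta by simp
  then have "generate_field ambient {y} = generate_field ambient {\<xi>}"
    using xi by (rule generate_primitive_root_cong)
  then show False using L L_generated_by_pth_root[OF y] by simp
qed

end

theorem theorem4p3:
  fixes p e :: nat
    and \<zeta> \<xi> :: "'a :: {alg_closed_field, field_char_0}"
    and F K L :: "'a set"
    and \<tau> :: "'a \<Rightarrow> 'a"
  assumes closure_of_Rats: "\<forall>z::'a. algebraic z"
    and p: "prime p" "odd p"
    and F: "cyclic_extension p F \<rat>"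
    and zeta: "primitive_root_of_unity p \<zeta>"
    and xi: "primitive_root_of_unity (p\<^sup>2) \<xi>"
    and K: "K = generate_field ambient {\<zeta>}"
    and L: "L = generate_field ambient (F \<union> K)"
    and e: "residue_primroot p e"
    and tau: "\<tau> \<in> carrier (galois_group L F)"
      "generate (galois_group L F) {\<tau>} = carrier (galois_group L F)"
      "\<tau> \<zeta> = \<zeta> ^ e"
  shows
    "(L = generate_field ambient {\<xi>} \<longrightarrow>
        (\<forall>x\<in>L - {0}. induces_Heisenberg p e \<tau> L K x \<longleftrightarrow> induces_semidirect p e \<tau> \<zeta> L K x)) \<and>
     (L \<noteq> generate_field ambient {\<xi>} \<longrightarrow>
        (\<forall>x\<in>L - {0}. \<not> induces_Heisenberg p e \<tau> L K x \<longrightarrow> induces_semidirect p e \<tau> \<zeta> L K x)) \<and>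
     infinite {x \<in> L - {0}. induces_Heisenberg p e \<tau> L K x \<and> induces_semidirect p e \<tau> \<zeta> L K x}"
proof -
  interpret cyclic_kummer_setup p e \<zeta> F K L \<tau>
    using assms by unfold_locales auto
  have "\<xi> \<in> L" if "L = generate_field ambient {\<xi>}"
    using that generate_field_contains by blast
  then show ?thesis
    using induces_iff_if_xi_in_L[OF xi] induces_one_of_both[OF xi] infinitely_many_inducing_both by blast
qed

end
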